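(* Let $n$ be a positive integer and $0 \le j_1 < j_2 < \dots < j_{n-1} \le 2n-3$ integers. The number $\ast(n;j_1,\dots,j_{n-1})$ of alternating sign triangles of order $n$ whose $1$-columns, other than the central column, are exactly those in positions $j_1,\dots,j_{n-1}$ equals the coefficient of $X_1^{j_1}X_2^{j_2}\cdots X_{n-1}^{j_{n-1}}$ in $$\prod_{i=1}^{n-1}(1+X_i)\prod_{1\le i<j\le n-1}(1+X_i+X_iX_j)(X_j-X_i).$$
   Context: An alternating sign triangle (AST) of order $n$ is a triangular array $(a_{i,j})_{1\le i\le n,\ i\le j\le 2n-i}$ (row $i$ has entries $a_{i,i},\dots,a_{i,2n-i}$; entries with the same $j$ form column $j$; there are $2n-1$ columns, the central one being column $n$) with entries in $\{0,1,-1\}$ such that: (1) the non-zero entries alternate in sign in each row and in each column; (2) every row sum is $1$; (3) the topmost non-zero entry of each column (if any) is $1$. A $1$-column is a column with sum $1$ (the central column is always one, and there are exactly $n$ of them). Positions of the non-central columns are counted from the left starting with $0$, disregarding the central column, so they range over $0,1,\dots,2n-3$. *)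

theory Defs
  imports Main "HOL-Library.Poly_Mapping"
begin

definition row_cols :: "nat \<Rightarrow> nat \<Rightarrow> nat set" where
  "row_cols n i = {i..2 * n - i}"

definition col_rows :: "nat \<Rightarrow> nat \<Rightarrow> nat set" where
  "col_rows n c = {i \<in> {1..n}. c \<in> row_cols n i}"

definition alternates_on :: "nat set \<Rightarrow> (nat \<Rightarrow> int) \<Rightarrow> bool" where
  "alternates_on S f \<longleftrightarrow>
     (\<forall>x\<in>S. \<forall>y\<in>S. x < y \<and> f x \<noteq> 0 \<and> f y \<noteq> 0 \<and> (\<forall>z\<in>S. x < z \<and> z < y \<longrightarrow> f z = 0)
        \<longrightarrow> sgn (f y) = - sgn (f x))"

text \<open>An array is a total function \<open>a i c\<close> (row, column). The last conjunct fixes its values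
  outside the triangle to \<open>0\<close>, so that distinct functions are distinct triangles and the functions
  can be counted; no other conjunct looks at entries outside the triangle.\<close>

definition is_AST :: "nat \<Rightarrow> (nat \<Rightarrow> nat \<Rightarrow> int) \<Rightarrow> bool" where
  "is_AST n a \<longleftrightarrow>
     (\<forall>i\<in>{1..n}. \<forall>c\<in>row_cols n i. a i c \<in> {0, 1, -1}) \<and>
     (\<forall>i\<in>{1..n}. alternates_on (row_cols n i) (a i)) \<and>
     (\<forall>c\<in>{1..2 * n - 1}. alternates_on (col_rows n c) (\<lambda>i. a i c)) \<and>
     (\<forall>i\<in>{1..n}. (\<Sum>c\<in>row_cols n i. a i c) = 1) \<and>
     (\<forall>c\<in>{1..2 * n - 1}. \<forall>i\<in>col_rows n c.
        a i c \<noteq> 0 \<and> (\<forall>k\<in>col_rows n c. k < i \<longrightarrow> a k c = 0) \<longrightarrow> a i c = 1) \<and>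
     (\<forall>i c. \<not> (i \<in> {1..n} \<and> c \<in> row_cols n i) \<longrightarrow> a i c = 0)"

definition is_one_col :: "nat \<Rightarrow> (nat \<Rightarrow> nat \<Rightarrow> int) \<Rightarrow> nat \<Rightarrow> bool" where
  "is_one_col n a c \<longleftrightarrow> (\<Sum>i\<in>col_rows n c. a i c) = 1"

text \<open>Only meaningful for non-central columns \<open>c \<noteq> n\<close>.\<close>

definition col_position :: "nat \<Rightarrow> nat \<Rightarrow> nat" where
  "col_position n c = (if c < n then c - 1 else c - 2)"

definition one_col_positions :: "nat \<Rightarrow> (nat \<Rightarrow> nat \<Rightarrow> int) \<Rightarrow> nat set" where
  "one_col_positions n a = col_position n ` {c \<in> {1..2 * n - 1} - {n}. is_one_col n a c}"

definition num_AST :: "nat \<Rightarrow> (nat \<Rightarrow> nat) \<Rightarrow> nat" where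
  "num_AST n j = card {a. is_AST n a \<and> one_col_positions n a = j ` {1..n - 1}}"

text \<open>Multivariate integer polynomials in \<open>X\<^sub>0, X\<^sub>1, \<dots>\<close> are finitely supported maps from exponent
  vectors \<open>nat \<Rightarrow>\<^sub>0 nat\<close> to \<open>int\<close>; \<^const>\<open>Poly_Mapping.lookup\<close> extracts a coefficient.\<close>

type_synonym mpoly_int = "(nat \<Rightarrow>\<^sub>0 nat) \<Rightarrow>\<^sub>0 int"

definition X :: "nat \<Rightarrow> mpoly_int" where
  "X i = Poly_Mapping.single (Poly_Mapping.single i 1) 1"

definition coeff_monom :: "mpoly_int \<Rightarrow> nat set \<Rightarrow> (nat \<Rightarrow> nat) \<Rightarrow> int" where
  "coeff_monom p I e = Poly_Mapping.lookup p (\<Sum>i\<in>I. Poly_Mapping.single i (e i))"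

end

theory Submission
  imports Defs "Jordan_Normal_Form.Determinant"
begin

text \<open>
The columns with sum \<open>1\<close> after \<open>k\<close> rows form a set \<open>S\<^sub>k\<close> with \<open>k\<close> elements; an AST is a chain
\<open>S\<^sub>0, S\<^sub>1, \<dots>, S\<^sub>n\<close> in which consecutive sets interlace and \<open>S\<^sub>k\<^sub>-\<^sub>1\<close>, \<open>S\<^sub>k\<close> differ only on the
columns \<open>k..2n-k\<close>. Write \<open>w\<^sub>p\<close> for the shift of the \<open>p\<close>-th variable, \<open>N = \<Prod>\<^sub>p\<^sub><\<^sub>q (1 - w\<^sub>p + w\<^sub>p w\<^sub>q)\<close>, and let \<open>\<Lambda>\<close>
apply a Laurent polynomial in the \<open>w\<^sub>p\<close> to \<open>det (x\<^sub>p choose q)\<close> and evaluate at \<open>0\<close>. By induction on \<open>k\<close>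
the number of chains ending in \<open>{s\<^sub>0 < \<dots> < s\<^sub>k\<^sub>-\<^sub>1}\<close> is \<open>\<Lambda> (N \<Prod>\<^sub>p f\<^sub>p (w\<^sub>p))\<close>, where \<open>f\<^sub>p\<close> is
\<open>w powi (s\<^sub>p - n)\<close> for a column that is still active and picks up a factor \<open>1 - w\<close> or \<open>(w - 1) / w\<close> for each row
after the column has been left on the left or right. In the induction step the sum over interlacing sets
telescopes: the mixed boundary terms contain \<open>(1 - w\<^sub>p + w\<^sub>p w\<^sub>q) (1 - w\<^sub>q + w\<^sub>p w\<^sub>q)\<close> for adjacent \<open>p, q\<close>, are
symmetric, and are killed by the determinant; the remaining ones are a Laplace expansion.

Symmetric Laurent polynomials act under \<open>\<Lambda>\<close> as constants. For the variables \<open>w\<^sub>l\<close> of the left columns this gives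
\<open>\<Prod>\<^sub>q (1 - w\<^sub>l + w\<^sub>l w\<^sub>q) \<equiv> 1\<close> and \<open>\<Prod>\<^sub>q (1 - w\<^sub>q + w\<^sub>l w\<^sub>q) \<equiv> w\<^sub>l ^ m\<close> (products over all \<open>m\<close> variables), hence
the left variables can be moved across the right ones. After that, the substitutions \<open>w\<^sub>l = 1 / (1 + X\<^sub>l)\<close> on the
left and \<open>w\<^sub>q = 1 + 1 / X\<^sub>q\<close> on the right turn \<open>\<Lambda>\<close> into the extraction of the coefficient, the determinant
becoming the Vandermonde product of the \<open>-1 - 1 / X\<^sub>l\<close> and \<open>X\<^sub>q\<close>.
\<close>

section \<open>Linear functionals on Laurent polynomials\<close>

text \<open>The linear extension of \<open>\<phi>\<close> from monomials to polynomials.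
  Evaluations, renamings, determinantal functionals and coefficient extraction are all of this
  form.\<close>

definition linext :: "('a \<Rightarrow> 'b::comm_ring_1) \<Rightarrow> ('a \<Rightarrow>\<^sub>0 int) \<Rightarrow> 'b" where
  "linext \<phi> P = (\<Sum>a\<in>Poly_Mapping.keys P. of_int (Poly_Mapping.lookup P a) * \<phi> a)"

lemma linext_superset:
  assumes "finite A" "Poly_Mapping.keys P \<subseteq> A"
  shows "linext \<phi> P = (\<Sum>a\<in>A. of_int (Poly_Mapping.lookup P a) * \<phi> a)"
  unfolding linext_def
  by (rule sum.mono_neutral_left) (use assms in \<open>auto simp: in_keys_iff\<close>)

lemma linext_zero [simp]: "linext \<phi> 0 = 0"
  by (simp add: linext_def)

lemma linext_single [simp]: "linext \<phi> (Poly_Mapping.single a c) = of_int c * \<phi> a"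
  by (cases "c = 0") (simp_all add: linext_def)

lemma linext_add: "linext \<phi> (P + Q) = linext \<phi> P + linext \<phi> Q"
proof -
  let ?A = "Poly_Mapping.keys P \<union> Poly_Mapping.keys Q"
  have "Poly_Mapping.keys (P + Q) \<subseteq> ?A"
    by (rule Poly_Mapping.keys_add)
  then show ?thesis
    by (simp add: linext_superset[of ?A] lookup_add algebra_simps sum.distrib)
qed

lemma linext_uminus: "linext \<phi> (- P) = - linext \<phi> P"
  by (simp add: linext_def sum_negf)

lemma linext_diff: "linext \<phi> (P - Q) = linext \<phi> P - linext \<phi> Q"
  using linext_add[of \<phi> P "- Q"] by (simp add: linext_uminus)

lemma linext_sum: "linext \<phi> (\<Sum>i\<in>I. P i) = (\<Sum>i\<in>I. linext \<phi> (P i))"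
  by (induction I rule: infinite_finite_induct) (simp_all add: linext_add)

lemma linext_fun_sum: "linext (\<lambda>a. \<Sum>i\<in>I. \<phi> i a) P = (\<Sum>i\<in>I. linext (\<phi> i) P)"
  unfolding linext_def by (simp add: sum_distrib_left sum.swap[of _ I])

lemma linext_fun_cmult: "linext (\<lambda>a. c * \<phi> a) P = c * linext \<phi> P"
  unfolding linext_def sum_distrib_left by (simp add: mult.left_commute)

lemma linext_fun_multc: "linext (\<lambda>a. \<phi> a * c) P = linext \<phi> P * c"
  unfolding linext_def sum_distrib_right by (simp add: mult.assoc)

lemma linext_one: "linext \<phi> 1 = \<phi> (0 :: 'a::zero)"
  by (simp flip: single_one)

lemma linext_mult:
  "linext \<phi> (P * Q) = linext (\<lambda>a. linext (\<lambda>b. \<phi> (a + b)) Q) (P :: 'a::monoid_add \<Rightarrow>\<^sub>0 int)"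
proof -
  \<comment> \<open>Finitely supported maps into \<open>int\<close> form the free abelian group on
    the monomials, so additivity reduces each factor to a single monomial.\<close>
  have single: "linext \<phi> (Poly_Mapping.single a 1 * Q) = linext (\<lambda>b. \<phi> (a + b)) Q" for a
  proof (rule frag_induction[OF subset_UNIV, of _ Q])
    fix x show "linext \<phi> (Poly_Mapping.single a 1 * frag_of x) = linext (\<lambda>b. \<phi> (a + b)) (frag_of x)"
      by (simp add: mult_single)
  qed (simp_all add: right_diff_distrib linext_diff)
  show ?thesis
    by (rule frag_induction[OF subset_UNIV, of _ P])
       (simp_all add: single left_diff_distrib linext_diff)
qed

lemma linext_hom:
  assumes "\<And>a b. \<chi> (a + b) = \<chi> a * \<chi> (b :: 'a::monoid_add)"
  shows "linext \<chi> (P * Q) = linext \<chi> P * linext \<chi> Q"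
  by (simp add: linext_mult assms linext_fun_cmult linext_fun_multc)

lemma linext_hom_prod:
  assumes "\<And>a b. \<chi> (a + b) = \<chi> a * \<chi> (b :: 'a::comm_monoid_add)" and "\<chi> 0 = 1"
  shows "linext \<chi> (\<Prod>i\<in>I. P i) = (\<Prod>i\<in>I. linext \<chi> (P i))"
  by (induction I rule: infinite_finite_induct) (simp_all add: linext_hom[OF assms(1)] linext_one assms(2))

lemma linext_cmult_int: "linext \<phi> (of_int c * P) = of_int c * linext \<phi> (P :: 'a::monoid_add \<Rightarrow>\<^sub>0 int)"
proof -
  have *: "of_int c * P = Poly_Mapping.single 0 c * P"
    by (metis id_apply of_int_eq_id single_of_int)
  show ?thesis unfolding * linext_mult by simp
qed

lemma linext_linext_single:
  "linext \<phi> (linext (\<lambda>a. Poly_Mapping.single (h a :: 'a::comm_monoid_add) 1) P) = linext (\<lambda>a. \<phi> (h a)) P"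
  by (simp add: linext_def[of _ P] linext_sum linext_cmult_int)

lemma linext_linext:
  fixes h :: "'c \<Rightarrow> ('a::comm_monoid_add \<Rightarrow>\<^sub>0 int)"
  shows "linext \<phi> (linext h P) = linext (\<lambda>a. linext \<phi> (h a)) P"
  by (simp add: linext_def[of _ P] linext_sum linext_cmult_int)

section \<open>Laurent polynomials in the shifts and their action on functions\<close>

type_synonym laurent = "int \<Rightarrow>\<^sub>0 int"
type_synonym mlaurent = "(nat \<Rightarrow>\<^sub>0 int) \<Rightarrow>\<^sub>0 int"

definition shift :: "int \<Rightarrow> laurent" where
  "shift x = Poly_Mapping.single x 1"

text \<open>Substitutes the p-th variable into a one-variable Laurent polynomial;
  \<open>emb p (shift 1)\<close> is the \<open>w_p\<close> of the overview.\<close>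

definition emb :: "nat \<Rightarrow> laurent \<Rightarrow> mlaurent" where
  "emb p f = linext (\<lambda>e. Poly_Mapping.single (Poly_Mapping.single p e) 1) f"

lemma shift_0 [simp]: "shift 0 = 1"
  by (simp add: shift_def)

lemma shift_add: "shift (x + y) = shift x * shift y"
  by (simp add: shift_def mult_single)

lemma shift_power: "shift x ^ k = shift (int k * x)"
  by (induction k) (simp_all add: shift_add algebra_simps)

lemma linext_shift [simp]: "linext \<phi> (shift x) = \<phi> x"
  by (simp add: shift_def)

lemma emb_mult: "emb p (f * g) = emb p f * emb p g"
  unfolding emb_def by (rule linext_hom) (simp add: mult_single single_add)

lemma emb_one [simp]: "emb p 1 = 1"
  by (simp add: emb_def linext_one)

lemma emb_add: "emb p (f + g) = emb p f + emb p g"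
  and emb_diff: "emb p (f - g) = emb p f - emb p g"
  and emb_uminus: "emb p (- f) = - emb p f"
  by (simp_all add: emb_def linext_add linext_diff linext_uminus)

lemma emb_power: "emb p (f ^ k) = emb p f ^ k"
  by (induction k) (simp_all add: emb_mult)

lemma emb_of_int [simp]: "emb p (of_int c) = of_int c"
proof -
  have "emb p (of_int c) = of_int c * emb p 1"
    unfolding emb_def by (subst linext_cmult_int[symmetric]) simp
  then show ?thesis by simp
qed

lemma linext_mult_emb:
  "linext \<phi> (P * emb p f) = linext (\<lambda>a. linext (\<lambda>e. \<phi> (a + Poly_Mapping.single p e)) f) P"
  by (simp add: linext_mult emb_def linext_linext_single)

text \<open>Laurent polynomials act as difference operators: \<open>shift y\<close> translates the
  argument by \<open>y\<close>, so \<open>shift 1 - 1\<close> is the forward difference.\<close>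

definition act :: "laurent \<Rightarrow> (int \<Rightarrow> 'b::comm_ring_1) \<Rightarrow> int \<Rightarrow> 'b" where
  "act f h x = linext (\<lambda>e. h (x + e)) f"

lemma act_one [simp]: "act 1 h = h"
  by (simp add: act_def linext_one fun_eq_iff)

lemma act_shift: "act (shift y) h x = h (x + y)"
  by (simp add: act_def)

lemma act_add: "act (f + g) h x = act f h x + act g h x"
  and act_diff: "act (f - g) h x = act f h x - act g h x"
  and act_uminus: "act (- f) h x = - act f h x"
  by (simp_all add: act_def linext_add linext_diff linext_uminus)

lemma act_mult: "act (f * g) h x = act f (act g h) x"
  by (simp add: act_def linext_mult add.assoc)

lemma act_zero: "act f h 0 = linext h f"
  by (simp add: act_def)

text \<open>The functional factors over the variables, so multiplication by a polynomial in the p-th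
  variable changes only the p-th factor. The functional stays a product over \<open>J\<close> while
  the induction runs over \<open>I\<close>.\<close>

lemma linext_mult_prod_emb_aux:
  assumes "finite J" "I \<subseteq> J"
  shows "linext (\<lambda>a. \<Prod>p\<in>J. h p (Poly_Mapping.lookup a p)) (P * (\<Prod>p\<in>I. emb p (f p))) =
    linext (\<lambda>a. \<Prod>p\<in>J. (if p \<in> I then act (f p) (h p) else h p) (Poly_Mapping.lookup a p)) P"
proof -
  have "finite I" using assms finite_subset by blast
  then show ?thesis using assms(2)
  proof (induction I arbitrary: P)
    case empty
    then show ?case by simp
  next
    case (insert q I)
    let ?g = "\<lambda>p. if p \<in> I then act (f p) (h p) else h p"
    let ?g' = "\<lambda>p. if p \<in> insert q I then act (f p) (h p) else h p"
    have q: "q \<in> J" using insert.prems by simp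
    have *: "linext (\<lambda>e. \<Prod>p\<in>J. ?g p (Poly_Mapping.lookup (a + Poly_Mapping.single q e) p)) (f q) =
        (\<Prod>p\<in>J. ?g' p (Poly_Mapping.lookup a p))" for a
    proof -
      have "(\<Prod>p\<in>J. ?g p (Poly_Mapping.lookup (a + Poly_Mapping.single q e) p)) =
          h q (Poly_Mapping.lookup a q + e) * (\<Prod>p\<in>J - {q}. ?g' p (Poly_Mapping.lookup a p))" for e
        by (subst prod.remove[OF assms(1) q])
           (use insert.hyps in \<open>auto intro!: prod.cong arg_cong2[of _ _ _ _ "(*)"] simp: lookup_add lookup_single\<close>)
      then show ?thesis
        by (simp add: linext_fun_multc prod.remove[OF assms(1) q] act_def)
    qed
    have "P * (\<Prod>p\<in>insert q I. emb p (f p)) = (P * emb q (f q)) * (\<Prod>p\<in>I. emb p (f p))"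
      using insert.hyps by (simp add: mult_ac)
    then show ?case
      using insert.prems by (simp only: insert.IH linext_mult_emb * insert_subset simp_thms)
  qed
qed

lemma linext_mult_prod_emb:
  assumes "finite I"
  shows "linext (\<lambda>a. \<Prod>p\<in>I. h p (Poly_Mapping.lookup a p)) (P * (\<Prod>p\<in>I. emb p (f p))) =
    linext (\<lambda>a. \<Prod>p\<in>I. act (f p) (h p) (Poly_Mapping.lookup a p)) P"
  by (subst linext_mult_prod_emb_aux[OF assms subset_refl]) (simp cong: prod.cong)

lemma linext_prod_emb:
  assumes "finite I"
  shows "linext (\<lambda>a. \<Prod>p\<in>I. h p (Poly_Mapping.lookup a p)) (\<Prod>p\<in>I. emb p (f p)) = (\<Prod>p\<in>I. linext (h p) (f p))"
  using linext_mult_prod_emb[OF assms, of h 1 f] by (simp add: linext_one act_zero)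

lemma det_mat_leibniz:
  "det (mat k k (\<lambda>(i, j). M i j)) = (\<Sum>\<pi> | \<pi> permutes {0..<k}. signof \<pi> * (\<Prod>i = 0..<k. M i (\<pi> i)))"
  by (subst det_def'[of _ k]) (auto intro!: sum.cong prod.cong arg_cong2[of _ _ _ _ "(*)"] simp: permutes_in_image)

text \<open>Row \<open>i\<close> of the determinant depends on the exponent of variable
  \<open>i\<close> alone, so in each Leibniz term the factors act row by row.\<close>

lemma linext_det_mult_prod_emb:
  "linext (\<lambda>a. det (mat k k (\<lambda>(i, j). h i j (Poly_Mapping.lookup a i)))) (P * (\<Prod>p<k. emb p (f p))) =
   linext (\<lambda>a. det (mat k k (\<lambda>(i, j). act (f i) (h i j) (Poly_Mapping.lookup a i)))) P"
  unfolding det_mat_leibniz linext_fun_sum linext_fun_cmult atLeast0LessThan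
  by (intro sum.cong refl arg_cong2[of _ _ _ _ "(*)"] linext_mult_prod_emb) simp

lemma linext_det_prod_emb:
  "linext (\<lambda>a. det (mat k k (\<lambda>(i, j). h i j (Poly_Mapping.lookup a i)))) (\<Prod>p<k. emb p (f p)) =
   det (mat k k (\<lambda>(i, j). linext (h i j) (f i)))"
  using linext_det_mult_prod_emb[of k h 1 f] by (simp add: linext_one act_zero)

section \<open>Determinantal functionals and coinvariants\<close>

lemma act_cmult_int: "act (of_int c * f) h x = of_int c * act f h x"
  by (simp add: act_def linext_cmult_int)

definition binom :: "int \<Rightarrow> nat \<Rightarrow> rat" where
  "binom x e = of_int x gchoose e"

lemma binom_0 [simp]: "binom x 0 = 1"
  by (simp add: binom_def)

lemma binom_Suc: "binom (x + 1) (Suc e) = binom x (Suc e) + binom x e"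
  by (simp add: binom_def gbinomial_Suc_Suc)

lemma binom_zero_left: "binom 0 e = (if e = 0 then 1 else 0)"
  by (cases e) (simp_all add: binom_def)

definition Lam :: "nat \<Rightarrow> mlaurent \<Rightarrow> rat" where
  "Lam k = linext (\<lambda>a. det (mat k k (\<lambda>(i, j). binom (Poly_Mapping.lookup a i) j)))"

text \<open>Antidifferences of the columns used in \<open>Lam\<close>, so that dividing by all \<open>w\<^sub>p - 1\<close> turns \<open>Lam\<close> into \<open>LamS\<close>.\<close>

definition LamS :: "nat \<Rightarrow> mlaurent \<Rightarrow> rat" where
  "LamS k = linext (\<lambda>a. det (mat k k (\<lambda>(i, j). binom (Poly_Mapping.lookup a i) (Suc j))))"

lemma act_diff_binom: "act (shift 1 - 1) (\<lambda>x. binom x e) x = (case e of 0 \<Rightarrow> 0 | Suc e' \<Rightarrow> binom x e')"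
  by (auto simp: act_diff act_shift binom_Suc split: nat.splits)

text \<open>By Pascal's rule the forward difference lowers the binomial in column \<open>j\<close>
  from \<open>Suc j\<close> to \<open>j\<close>. This introduces the factors \<open>w_p - 1\<close>
  that make the later sums telescope.\<close>

lemma LamS_lift: "LamS k (P * (\<Prod>p<k. emb p (shift 1 - 1))) = Lam k P"
  unfolding LamS_def Lam_def linext_det_mult_prod_emb[where h = "\<lambda>_ j x. binom x (Suc j)"]
  by (simp add: act_diff_binom)

text \<open>Applying \<open>1 + b * (shift 1 - 1)\<close> in all rows adds to each column
  \<open>b\<close> times the previous one. That is right multiplication by the unitriangular matrix
  \<open>T\<close>, which leaves the determinant unchanged.\<close>

lemma Lam_coinv_int:
  "Lam k (P * (\<Prod>p<k. emb p (1 + of_int b * (shift 1 - 1)))) = Lam k P"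
proof -
  have "det (mat k k (\<lambda>(i, j). act (1 + of_int b * (shift 1 - 1)) (\<lambda>x. binom x j) (Poly_Mapping.lookup a i))) =
      det (mat k k (\<lambda>(i, j). binom (Poly_Mapping.lookup a i) j))" (is "det ?M' = det ?M") for a :: "nat \<Rightarrow>\<^sub>0 int"
  proof -
    define T :: "rat mat" where "T = mat k k (\<lambda>(i, j). if i = j then 1 else if Suc i = j then of_int b else 0)"
    have T: "T \<in> carrier_mat k k" by (simp add: T_def)
    have "?M' = ?M * T"
    proof (rule eq_matI)
      fix i j assume ij: "i < dim_row (?M * T)" "j < dim_col (?M * T)"
      then have i: "i < k" and j: "j < k" by (simp_all add: T_def)
      have "(?M * T) $$ (i, j) = (\<Sum>l<k. binom (Poly_Mapping.lookup a i) l * T $$ (l, j))"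
        using i j by (simp add: T_def scalar_prod_def atLeast0LessThan)
      also have "\<dots> = (\<Sum>l<k. (if l = j then binom (Poly_Mapping.lookup a i) l else 0) +
          (if Suc l = j then binom (Poly_Mapping.lookup a i) l * of_int b else 0))"
        using j by (intro sum.cong) (auto simp: T_def)
      also have "\<dots> = binom (Poly_Mapping.lookup a i) j +
          (case j of 0 \<Rightarrow> 0 | Suc j' \<Rightarrow> of_int b * binom (Poly_Mapping.lookup a i) j')"
        using j by (cases j) (auto simp: sum.distrib)
      finally show "?M' $$ (i, j) = (?M * T) $$ (i, j)"
        using i j by (simp add: act_add act_cmult_int act_diff_binom split: nat.splits)
    qed (simp_all add: T_def)
    moreover have "det T = 1"
    proof -
      have "det T = prod_list (diag_mat T)"
        by (rule det_upper_triangular[OF _ T]) (auto simp: T_def upper_triangular_def)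
      also have "diag_mat T = replicate k 1"
        by (auto simp: diag_mat_def T_def intro!: replicate_eqI)
      finally show ?thesis by simp
    qed
    moreover have "?M \<in> carrier_mat k k" by simp
    ultimately show ?thesis by (simp add: det_mult[OF _ T])
  qed
  then show ?thesis
    unfolding Lam_def linext_det_mult_prod_emb[where h = "\<lambda>_ j x. binom x j"] by simp
qed

lemma Lam_sum: "Lam k (\<Sum>i\<in>I. R i) = (\<Sum>i\<in>I. Lam k (R i))"
  and Lam_cmult_int: "Lam k (of_int c * P) = of_int c * Lam k P"
  by (simp_all add: Lam_def linext_sum linext_cmult_int)

lemma prod_one_plus_cmult:
  fixes y :: "nat \<Rightarrow> 'a::comm_ring_1"
  shows "(\<Prod>q<k. 1 + b * y q) = (\<Sum>j\<le>k. b ^ j * (\<Sum>J | J \<subseteq> {..<k} \<and> card J = j. \<Prod>q\<in>J. y q))"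
proof -
  have "(\<Prod>q<k. 1 + b * y q) = (\<Sum>J\<in>Pow {..<k}. b ^ card J * (\<Prod>q\<in>J. y q))"
    using prod_add[of "{..<k}" "\<lambda>q. b * y q" "\<lambda>_. 1"]
    by (simp add: add.commute[of 1] prod.distrib)
  also have "\<dots> = (\<Sum>j\<le>k. \<Sum>J | J \<in> Pow {..<k} \<and> card J = j. b ^ card J * (\<Prod>q\<in>J. y q))"
    by (rule sum.group[symmetric]) (auto intro: card_mono[of "{..<k}", simplified])
  also have "\<dots> = (\<Sum>j\<le>k. b ^ j * (\<Sum>J | J \<subseteq> {..<k} \<and> card J = j. \<Prod>q\<in>J. y q))"
    by (simp add: sum_distrib_left)
  finally show ?thesis .
qed

text \<open>Here \<open>b\<close> may itself be a polynomial in the variables. The elementary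
  symmetric polynomials \<open>E j\<close> in the \<open>w_q - 1\<close> with \<open>0 < j\<close>
  vanish under \<open>Lam\<close> even with an arbitrary cofactor, so only the term
  \<open>j = 0\<close> of the expansion in powers of \<open>b\<close> survives.\<close>

lemma Lam_coinv:
  "Lam k (H * (\<Prod>q<k. 1 + b * emb q (shift 1 - 1))) = Lam k H"
proof -
  define E where "E j = (\<Sum>J | J \<subseteq> {..<k} \<and> card J = j. \<Prod>q\<in>J. emb q (shift 1 - 1))" for j
  have E0: "E 0 = 1"
  proof -
    have "{J. J \<subseteq> {..<k} \<and> card J = 0} = {{}}"
      by (auto simp: card_eq_0_iff dest: finite_subset)
    then show ?thesis by (simp add: E_def)
  qed
  have E: "Lam k (P * E j) = 0" if "0 < j" "j \<le> k" for P j
  proof -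
    \<comment> \<open>A rational polynomial whose value at an integer \<open>t\<close> is the
      difference of the two sides of \<open>Lam_coinv_int\<close>. It has infinitely many roots,
      hence is zero, and its coefficient at the given positive \<open>j\<close> is
      \<open>Lam k (P * E j)\<close>.\<close>
    define p where "p = (\<Sum>i\<le>k. monom (Lam k (P * E i)) i) - [:Lam k P:]"
    have "poly p (of_int t) = 0" for t :: int
    proof -
      have "Lam k P = Lam k (P * (\<Prod>q<k. 1 + of_int t * emb q (shift 1 - 1)))"
        using Lam_coinv_int[of k P t] by (simp add: emb_add emb_mult)
      also have "\<dots> = (\<Sum>i\<le>k. Lam k (of_int (t ^ i) * (P * E i)))"
        by (simp add: prod_one_plus_cmult E_def[symmetric] sum_distrib_left Lam_sum mult_ac)
      also have "\<dots> = (\<Sum>i\<le>k. of_int t ^ i * Lam k (P * E i))"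
        using Lam_cmult_int[of k "t ^ _"] by (simp del: of_int_power add: of_int_power[symmetric])
      finally show ?thesis
        by (simp add: p_def poly_sum poly_monom mult.commute)
    qed
    then have "range of_int \<subseteq> {x. poly p x = 0}" by auto
    moreover have "infinite (range (of_int :: int \<Rightarrow> rat))"
      by (simp add: finite_image_iff inj_on_def)
    ultimately have "p = 0"
      using poly_roots_finite[of p] finite_subset by blast
    then have "coeff p j = 0" by simp
    then show ?thesis
      using that by (simp add: p_def coeff_sum coeff_pCons split: nat.splits)
  qed
  have "Lam k (H * (\<Prod>q<k. 1 + b * emb q (shift 1 - 1))) = (\<Sum>j\<le>k. Lam k ((H * b ^ j) * E j))"
    by (simp add: prod_one_plus_cmult E_def[symmetric] sum_distrib_left Lam_sum mult_ac)
  also have "\<dots> = (\<Sum>j\<le>k. if j = 0 then Lam k H else 0)"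
    by (intro sum.cong refl) (auto simp: E E0)
  finally show ?thesis by simp
qed

text \<open>Exponents are pulled back along \<open>f\<close>. For injective \<open>f\<close> this
  turns variable \<open>f p\<close> into variable \<open>p\<close> and sets every variable outside
  the range of \<open>f\<close> to 1.\<close>

definition ren :: "(nat \<Rightarrow> nat) \<Rightarrow> mlaurent \<Rightarrow> mlaurent" where
  "ren f P = linext (\<lambda>a. Poly_Mapping.single (Poly_Mapping.map_key f a) 1) P"

lemma linext_ren: "linext \<phi> (ren f P) = linext (\<lambda>a. \<phi> (Poly_Mapping.map_key f a)) P"
  by (simp add: ren_def linext_linext_single)

lemma lookup_map_key: "inj f \<Longrightarrow> Poly_Mapping.lookup (Poly_Mapping.map_key f a) x = Poly_Mapping.lookup a (f x)"
  by (simp add: map_key.rep_eq)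

lemma ren_mult: "inj f \<Longrightarrow> ren f (P * Q) = ren f P * ren f Q"
  unfolding ren_def by (rule linext_hom) (simp add: map_key_plus mult_single)

lemma ren_prod: "inj f \<Longrightarrow> ren f (\<Prod>i\<in>I. P i) = (\<Prod>i\<in>I. ren f (P i))"
  unfolding ren_def by (rule linext_hom_prod) (simp_all add: map_key_plus mult_single map_key_zero)

lemma ren_one [simp]: "inj f \<Longrightarrow> ren f 1 = 1"
  by (simp add: ren_def linext_one map_key_zero)

lemma ren_add: "ren f (P + Q) = ren f P + ren f Q"
  and ren_diff: "ren f (P - Q) = ren f P - ren f Q"
  and ren_uminus: "ren f (- P) = - ren f P"
  by (simp_all add: ren_def linext_add linext_diff linext_uminus)

lemma ren_emb: 
  assumes "inj f"
  shows "ren f (emb (f p) g) = emb p g"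
  unfolding ren_def emb_def using assms
  by (simp add: linext_linext map_key_single)

lemma ren_emb_notin:
  assumes "inj f" "q \<notin> range f"
  shows "ren f (emb q g) = of_int (linext (\<lambda>_. 1) g)"
proof -
  have "Poly_Mapping.map_key f (Poly_Mapping.single q e) = 0" for e :: int
    using assms by (intro poly_mapping_eqI) (auto simp: lookup_map_key lookup_single when_def)
  then have "ren f (emb q g) = linext (\<lambda>_. 1) g"
    by (simp add: ren_def emb_def linext_linext)
  also have "\<dots> = of_int (linext (\<lambda>_. 1) g)"
    by (simp add: linext_def)
  finally show ?thesis .
qed

section \<open>Antisymmetry and Laplace expansion of the functionals\<close>

abbreviation swp :: "nat \<Rightarrow> mlaurent \<Rightarrow> mlaurent" where
  "swp i \<equiv> ren (Transposition.transpose i (Suc i))"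

lemma LamS_swp:
  assumes "Suc i < k"
  shows "LamS k (swp i P) = - LamS k P"
proof -
  let ?t = "Transposition.transpose i (Suc i)"
  have "det (mat k k (\<lambda>(p, j). binom (Poly_Mapping.lookup a (?t p)) (Suc j))) =
      - det (mat k k (\<lambda>(p, j). binom (Poly_Mapping.lookup a p) (Suc j)))" (is "det ?M' = - det ?M") for a :: "nat \<Rightarrow>\<^sub>0 int"
  proof -
    have "?M' = swaprows i (Suc i) ?M"
      using assms by (intro eq_matI) (auto simp: Transposition.transpose_def)
    then show ?thesis
      using assms by (simp add: det_swaprows[of i k "Suc i"])
  qed
  then show ?thesis
    unfolding LamS_def linext_ren
    by (simp add: lookup_map_key inj_transpose linext_fun_cmult[of "-1", simplified])
qed

text \<open>A rational number equal to its own negative is zero. This is what removes the mixed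
  boundary terms in the telescoping.\<close>

lemma LamS_swp_invariant:
  assumes "Suc i < k" "swp i P = P"
  shows "LamS k P = 0"
  using LamS_swp[OF assms(1), of P] assms(2) by simp

text \<open>Expansion along column 0, whose entries \<open>binom x 0\<close> are all 1. Deleting row
  \<open>i\<close> amounts to setting variable \<open>i\<close> to 1 and renumbering, which is
  \<open>ren (insert_index i)\<close>; the remaining columns are those of
  \<open>LamS\<close>.\<close>

lemma Lam_laplace:
  "Lam (Suc k) P = (\<Sum>i<Suc k. (-1) ^ i * LamS k (ren (insert_index i) P))"
proof -
  have inj: "inj (insert_index i)" for i
    by (rule inj_on_inverseI[of _ "delete_index i"]) simp
  have "det (mat (Suc k) (Suc k) (\<lambda>(p, j). binom (Poly_Mapping.lookup a p) j)) =
    (\<Sum>i<Suc k. (-1) ^ i * det (mat k k (\<lambda>(p, j). binom (Poly_Mapping.lookup a (insert_index i p)) (Suc j))))"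
    (is "det ?M = _") for a :: "nat \<Rightarrow>\<^sub>0 int"
  proof -
    have "?M \<in> carrier_mat (Suc k) (Suc k)" by simp
    then have "det ?M = (\<Sum>i<Suc k. ?M $$ (i, 0) * cofactor ?M i 0)"
      by (rule laplace_expansion_column) simp
    also have "\<dots> = (\<Sum>i<Suc k. (-1) ^ i * det (mat k k (\<lambda>(p, j). binom (Poly_Mapping.lookup a (insert_index i p)) (Suc j))))"
    proof (intro sum.cong refl)
      fix i assume "i \<in> {..<Suc k}"
      then have "mat_delete ?M i 0 = mat k k (\<lambda>(p, j). binom (Poly_Mapping.lookup a (insert_index i p)) (Suc j))"
        by (intro eq_matI) (auto simp: mat_delete_def insert_index_def)
      then show "?M $$ (i, 0) * cofactor ?M i 0 =
          (-1) ^ i * det (mat k k (\<lambda>(p, j). binom (Poly_Mapping.lookup a (insert_index i p)) (Suc j)))"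
        using \<open>i \<in> {..<Suc k}\<close> by (simp add: cofactor_def)
    qed
    finally show ?thesis .
  qed
  then show ?thesis
    unfolding LamS_def Lam_def linext_ren
    by (simp only: linext_fun_sum linext_fun_cmult lookup_map_key[OF inj])
qed

section \<open>Interlacing sums\<close>

definition nf :: "nat \<Rightarrow> nat \<Rightarrow> mlaurent" where
  "nf p q = 1 - emb p (shift 1) + emb p (shift 1) * emb q (shift 1)"

definition nprod :: "nat \<Rightarrow> mlaurent" where
  "nprod k = (\<Prod>(p, q)\<in>{(p, q). p < q \<and> q < k}. nf p q)"

lemma finite_pairs: "finite {(p, q). p < q \<and> q < (k::nat)}"
  by (rule finite_subset[of _ "{..<k} \<times> {..<k}"]) auto

lemma swp_emb: "swp i (emb p g) = emb (Transposition.transpose i (Suc i) p) g"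
  using ren_emb[of "Transposition.transpose i (Suc i)" "Transposition.transpose i (Suc i) p" g]
  by (simp add: inj_transpose)

lemma swp_emb_other: "p \<noteq> i \<Longrightarrow> p \<noteq> Suc i \<Longrightarrow> swp i (emb p g) = emb p g"
  by (simp add: swp_emb)

lemma swp_nf:
  "swp i (nf p q) = nf (Transposition.transpose i (Suc i) p) (Transposition.transpose i (Suc i) q)"
  by (simp add: nf_def ren_add ren_diff ren_mult inj_transpose swp_emb)

text \<open>The transposition permutes the factors of \<open>nprod k\<close> except
  \<open>nf i (Suc i)\<close>, which becomes \<open>nf (Suc i) i\<close>. With both present the
  index set \<open>?A\<close> is closed under the exchange.\<close>

lemma swp_nprod:
  assumes "Suc i < k"
  shows "swp i (nprod k * nf (Suc i) i) = nprod k * nf (Suc i) i"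
proof -
  let ?t = "Transposition.transpose i (Suc i)"
  let ?A = "insert (Suc i, i) {(p, q). p < q \<and> q < k}"
  have *: "nprod k * nf (Suc i) i = (\<Prod>(p, q)\<in>?A. nf p q)"
    using finite_pairs[of k] by (simp add: nprod_def mult.commute)
  have "swp i (\<Prod>(p, q)\<in>?A. nf p q) = (\<Prod>(p, q)\<in>?A. nf (?t p) (?t q))"
    by (simp add: ren_prod inj_transpose swp_nf case_prod_unfold)
  also have "\<dots> = (\<Prod>(p, q)\<in>?A. nf p q)"
    by (rule prod.reindex_bij_witness[of _ "\<lambda>(p, q). (?t p, ?t q)" "\<lambda>(p, q). (?t p, ?t q)"])
       (use assms in \<open>auto simp: Transposition.transpose_def split: if_splits\<close>)
  finally show ?thesis unfolding * .
qed

lemma inj_insert_index: "inj (insert_index i)"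
  by (rule inj_on_inverseI[of _ "delete_index i"]) simp

text \<open>Evaluation at \<open>w = 1\<close>.\<close>

definition ev1 :: "laurent \<Rightarrow> int" where
  "ev1 = linext (\<lambda>_. 1)"

lemma ev1_shift [simp]: "ev1 (shift x) = 1"
  and ev1_one [simp]: "ev1 1 = 1"
  and ev1_mult: "ev1 (f * g) = ev1 f * ev1 g"
  and ev1_diff: "ev1 (f - g) = ev1 f - ev1 g"
  by (simp_all add: ev1_def linext_one linext_diff linext_hom)

lemma ren_insert_index_emb:
  "ren (insert_index i) (emb p g) =
    (if p < i then emb p g else if p = i then of_int (ev1 g) else emb (p - 1) g)"
proof (cases "p = i")
  case True
  have "i \<notin> range (insert_index i)"
    by (auto simp: insert_index_def)
  then show ?thesis
    using True by (simp add: ren_emb_notin inj_insert_index ev1_def)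
next
  case False
  have "insert_index i (if p < i then p else p - 1) = p"
    using False by (auto simp: insert_index_def)
  then show ?thesis
    using ren_emb[OF inj_insert_index, of i "if p < i then p else p - 1" g] False by auto
qed

text \<open>At \<open>w_i = 1\<close> the factor \<open>nf p i\<close> becomes 1 for
  \<open>p < i\<close>, and \<open>nf i q\<close> becomes \<open>w_q\<close> for
  \<open>i < q\<close>. The latter give the extra shifts, renumbered by one.\<close>

lemma ren_insert_index_nprod:
  assumes "i \<le> k"
  shows "ren (insert_index i) (nprod (Suc k)) = nprod k * (\<Prod>p\<in>{i..<k}. emb p (shift 1))"
proof -
  let ?A = "{(p, q). p < q \<and> q < Suc k \<and> p \<noteq> i \<and> q \<noteq> i}"
  let ?R = "\<lambda>(p, q). ren (insert_index i) (nf p q)"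
  have nf: "ren (insert_index i) (nf p q) = 1 - ren (insert_index i) (emb p (shift 1)) +
      ren (insert_index i) (emb p (shift 1)) * ren (insert_index i) (emb q (shift 1))" for p q
    by (simp add: nf_def ren_add ren_diff ren_mult inj_insert_index)
  have split: "{(p, q). p < q \<and> q < Suc k} = ?A \<union> ((\<lambda>p. (p, i)) ` {..<i} \<union> (\<lambda>q. (i, Suc q)) ` {i..<k})"
    using assms
    by (auto simp: image_iff Ball_def Bex_def) presburger+
  have fin: "finite ?A"
    by (rule finite_subset[OF _ finite_pairs[of "Suc k"]]) auto
  have "ren (insert_index i) (nprod (Suc k)) = prod ?R {(p, q). p < q \<and> q < Suc k}"
    by (simp add: nprod_def ren_prod inj_insert_index case_prod_unfold)
  also have "\<dots> = prod ?R ?A * (prod ?R ((\<lambda>p. (p, i)) ` {..<i}) * prod ?R ((\<lambda>q. (i, Suc q)) ` {i..<k}))"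
    unfolding split by (subst prod.union_disjoint) (use fin in \<open>auto intro!: prod.union_disjoint\<close>)
  also have "prod ?R ((\<lambda>p. (p, i)) ` {..<i}) = 1"
    by (subst prod.reindex) (auto simp: inj_on_def nf ren_insert_index_emb intro!: prod.neutral)
  also have "prod ?R ((\<lambda>q. (i, Suc q)) ` {i..<k}) = (\<Prod>p\<in>{i..<k}. emb p (shift 1))"
    by (subst prod.reindex) (auto simp: inj_on_def nf ren_insert_index_emb intro!: prod.cong)
  also have "prod ?R ?A = (\<Prod>(p, q)\<in>?A. nf (delete_index i p) (delete_index i q))"
    unfolding nf case_prod_unfold
    by (intro prod.cong refl) (auto simp: nf_def ren_insert_index_emb delete_index_def)
  also have "\<dots> = nprod k"
    unfolding nprod_def
    by (rule prod.reindex_bij_witness[of _ "\<lambda>(p, q). (insert_index i p, insert_index i q)"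
          "\<lambda>(p, q). (delete_index i p, delete_index i q)"])
       (use assms in \<open>auto simp: insert_index_def delete_index_def split: if_splits\<close>)
  finally show ?thesis by simp
qed

definition bethe :: "nat \<Rightarrow> (nat \<Rightarrow> laurent) \<Rightarrow> rat" where
  "bethe k f = Lam k ((\<Prod>p<k. emb p (f p)) * nprod k)"

text \<open>The extra \<open>shift 1\<close> on the variables after \<open>i\<close> is what
  \<open>N\<close> leaves behind at \<open>w_i = 1\<close>, by
  \<open>ren_insert_index_nprod\<close>.\<close>

lemma bethe_laplace:
  "bethe (Suc k) f = (\<Sum>i\<le>k. (-1) ^ i * of_int (ev1 (f i)) *
     LamS k ((\<Prod>p<i. emb p (f p)) * (\<Prod>p\<in>{i..<k}. emb p (f (Suc p) * shift 1)) * nprod k))"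
proof -
  have "ren (insert_index i) ((\<Prod>p<Suc k. emb p (f p)) * nprod (Suc k)) = of_int (ev1 (f i)) *
      ((\<Prod>p<i. emb p (f p)) * (\<Prod>p\<in>{i..<k}. emb p (f (Suc p) * shift 1)) * nprod k)" if "i \<le> k" for i
  proof -
    let ?F = "\<lambda>p. ren (insert_index i) (emb p (f p))"
    have "{..<Suc k} = insert i ({..<i} \<union> Suc ` {i..<k})"
      using that by (auto simp: image_Suc_atLeastLessThan)
    then have "prod ?F {..<Suc k} = ?F i * (prod ?F {..<i} * prod ?F (Suc ` {i..<k}))"
      by (simp add: prod.union_disjoint disjoint_iff image_iff del: image_Suc_atLeastLessThan)
    also have "\<dots> = of_int (ev1 (f i)) *
        ((\<Prod>p<i. emb p (f p)) * (\<Prod>p\<in>{i..<k}. emb p (f (Suc p))))"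
      by (simp add: prod.reindex ren_insert_index_emb del: image_Suc_atLeastLessThan)
    finally have "(\<Prod>p<Suc k. ren (insert_index i) (emb p (f p))) = of_int (ev1 (f i)) *
        ((\<Prod>p<i. emb p (f p)) * (\<Prod>p\<in>{i..<k}. emb p (f (Suc p))))" .
    then show ?thesis
      using that
      by (simp add: ren_mult inj_insert_index ren_prod ren_insert_index_nprod emb_mult prod.distrib mult_ac)
  qed
  moreover have "LamS k (of_int c * P) = of_int c * LamS k P" for c P
    by (simp add: LamS_def linext_cmult_int)
  ultimately show ?thesis
    unfolding bethe_def Lam_laplace lessThan_Suc_atMost by (simp add: mult.assoc)
qed

section \<open>Interlacing lists and the telescoping of sums over them\<close>

definition ilace :: "nat \<Rightarrow> (nat \<Rightarrow> nat) \<Rightarrow> nat list set" where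
  "ilace r x = {ys. length ys = r \<and> sorted_wrt (<) ys \<and> (\<forall>i<r. x i \<le> ys ! i \<and> ys ! i \<le> x (Suc i))}"

lemma ilace_0 [simp]: "ilace 0 x = {[]}"
  by (auto simp: ilace_def)

lemma ilace_1: "ilace (Suc 0) x = (\<lambda>y. [y]) ` {x 0..x 1}"
  by (auto simp: ilace_def length_Suc_conv)

lemma sorted_wrt_snoc_iff:
  "sorted_wrt (<) (ys @ [y]) \<longleftrightarrow> sorted_wrt (<) ys \<and> (ys = [] \<or> last ys < (y :: nat))"
  by (cases ys rule: rev_cases) (auto simp: sorted_wrt_append)

lemma ilace_snoc_iff:
  "ys @ [y] \<in> ilace (Suc r) x \<longleftrightarrow>
     ys \<in> ilace r x \<and> x r \<le> y \<and> y \<le> x (Suc r) \<and> (ys = [] \<or> last ys < y)"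
  by (auto simp: ilace_def sorted_wrt_snoc_iff nth_append less_Suc_eq)

lemma finite_ilace: "finite (ilace r x)"
proof (induction r)
  case (Suc r)
  have "ilace (Suc r) x \<subseteq> (\<lambda>(ys, y). ys @ [y]) ` (ilace r x \<times> {x r..x (Suc r)})"
  proof
    fix ys assume "ys \<in> ilace (Suc r) x"
    moreover from this have "ys \<noteq> []" by (auto simp: ilace_def)
    ultimately show "ys \<in> (\<lambda>(ys, y). ys @ [y]) ` (ilace r x \<times> {x r..x (Suc r)})"
      by (cases ys rule: rev_cases) (auto simp: ilace_snoc_iff)
  qed
  then show ?case using Suc finite_subset by blast
qed simp

text \<open>When the last entry is chosen freely in its interval, strictness can fail only if the
  last two entries both equal \<open>x (Suc r)\<close>. In that case the assumption keeps all
  earlier entries below \<open>x (Suc r)\<close>, so they are unrestricted otherwise.\<close>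

lemma ilace_Suc_Suc:
  assumes "x r < x (Suc r)"
  shows "(\<lambda>(ys, y). ys @ [y]) ` (ilace (Suc r) x \<times> {x (Suc r)..x (Suc (Suc r))}) =
     ilace (Suc (Suc r)) x \<union> (\<lambda>ys. ys @ [x (Suc r), x (Suc r)]) ` (if x (Suc r) \<le> x (Suc (Suc r)) then ilace r x else {})"
     (is "?L = ?R")
proof (intro equalityI subsetI)
  fix zs assume "zs \<in> ?L"
  then obtain ys y where zs: "zs = ys @ [y]" "ys \<in> ilace (Suc r) x" "x (Suc r) \<le> y" "y \<le> x (Suc (Suc r))"
    by auto
  then obtain us u where ys: "ys = us @ [u]"
    by (cases ys rule: rev_cases) (auto simp: ilace_def)
  have u: "us \<in> ilace r x" "u \<le> x (Suc r)"
    using zs(2) unfolding ys by (simp_all add: ilace_snoc_iff)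
  show "zs \<in> ?R"
  proof (cases "u < y")
    case True
    then have "zs \<in> ilace (Suc (Suc r)) x"
      unfolding zs(1) ilace_snoc_iff using zs ys by simp
    then show ?thesis ..
  next
    case False
    then have "u = x (Suc r)" "y = x (Suc r)" using u zs by auto
    then show ?thesis using zs(1) ys u zs(4) by auto
  qed
next
  fix zs assume "zs \<in> ?R"
  then consider "zs \<in> ilace (Suc (Suc r)) x"
    | us where "x (Suc r) \<le> x (Suc (Suc r))" "us \<in> ilace r x" "zs = us @ [x (Suc r), x (Suc r)]"
    by (auto split: if_splits)
  then show "zs \<in> ?L"
  proof cases
    case 1
    then obtain ys y where "zs = ys @ [y]"
      by (cases zs rule: rev_cases) (auto simp: ilace_def)
    with 1 show ?thesis by (auto simp: ilace_snoc_iff image_iff)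
  next
    case 2
    have "us = [] \<or> last us \<le> x r"
      using 2(2) by (cases us rule: rev_cases) (auto simp: ilace_def nth_append)
    then have "us @ [x (Suc r)] \<in> ilace (Suc r) x"
      using 2(2) assms by (auto simp: ilace_snoc_iff)
    then have "(us @ [x (Suc r)], x (Suc r)) \<in> ilace (Suc r) x \<times> {x (Suc r)..x (Suc (Suc r))}"
      using 2(1) by simp
    then show ?thesis unfolding 2(3) by (rule rev_image_eqI) simp
  qed
qed

text \<open>The sum over interlacing lists after the lift to \<open>LamS\<close>, in the variables
  from \<open>a\<close> to \<open>a + r - 1\<close>. The factor \<open>shift 1 - 1\<close> makes
  each geometric sum telescope; the offset \<open>d\<close> will be the central column.\<close>

definition block :: "int \<Rightarrow> nat \<Rightarrow> nat \<Rightarrow> (nat \<Rightarrow> nat) \<Rightarrow> mlaurent" where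
  "block d a r x = (\<Sum>ys\<in>ilace r x. \<Prod>i<r. emb (a + i) (shift (int (ys ! i) - d) * (shift 1 - 1)))"

lemma sum_shift_telescope:
  "u \<le> v \<Longrightarrow> (\<Sum>y=u..v. shift (int y - d) * (shift 1 - 1)) = shift (int v - d + 1) - shift (int u - d)"
proof (induction v rule: dec_induct)
  case base
  then show ?case by (simp add: algebra_simps flip: shift_add)
next
  case (step v)
  then have "{u..Suc v} = insert (Suc v) {u..v}" by auto
  with step show ?case by (simp add: algebra_simps flip: shift_add)
qed

lemma emb_sum: "emb p (\<Sum>i\<in>I. g i) = (\<Sum>i\<in>I. emb p (g i))"
  by (simp add: emb_def linext_sum)

lemma block_0: "block d a 0 x = 1"
  by (simp add: block_def)

lemma block_1:
  assumes "x 0 \<le> x 1"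
  shows "block d a (Suc 0) x = emb a (shift (int (x 1) - d + 1)) - emb a (shift (int (x 0) - d))"
proof -
  have "block d a (Suc 0) x = (\<Sum>y=x 0..x 1. emb a (shift (int y - d) * (shift 1 - 1)))"
    unfolding block_def ilace_1 by (subst sum.reindex) (auto simp: inj_on_def)
  then show ?thesis
    using sum_shift_telescope[OF assms] by (simp flip: emb_sum emb_diff)
qed

text \<open>By \<open>ilace_Suc_Suc\<close> the last variable is summed over its whole interval,
  where it telescopes, and the lists whose last two entries coincide are subtracted.\<close>

lemma block_Suc_Suc:
  assumes "x r < x (Suc r)" "x (Suc r) \<le> x (Suc (Suc r))"
  shows "block d a (Suc (Suc r)) x =
     block d a (Suc r) x * (emb (a + Suc r) (shift (int (x (Suc (Suc r))) - d + 1))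
       - emb (a + Suc r) (shift (int (x (Suc r)) - d)))
     - block d a r x * emb (a + r) (shift (int (x (Suc r)) - d) * (shift 1 - 1))
        * emb (a + Suc r) (shift (int (x (Suc r)) - d) * (shift 1 - 1))"
proof -
  define g where "g i y = emb (a + i) (shift (int y - d) * (shift 1 - 1))" for i y
  let ?u = "x (Suc r)"
  define G where "G m ys = (\<Prod>i<m. g i (ys ! i))" for m and ys :: "nat list"
  have b: "block d a m x = (\<Sum>ys\<in>ilace m x. G m ys)" for m
    by (simp add: block_def g_def G_def)
  have snoc: "G (Suc m) (ys @ [y]) = G m ys * g m y" if "length ys = m" for m ys y
    using that by (auto simp: G_def nth_append intro!: arg_cong2[of _ _ _ _ "(*)"] prod.cong)
  have len: "length ys = m" if "ys \<in> ilace m x" for ys m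
    using that by (simp add: ilace_def)
  have disj: "ilace (Suc (Suc r)) x \<inter> (\<lambda>ys. ys @ [?u, ?u]) ` ilace r x = {}"
    by (auto simp: ilace_def sorted_wrt_append)
  have "block d a (Suc r) x * (\<Sum>y=?u..x (Suc (Suc r)). g (Suc r) y) =
      (\<Sum>(ys, y)\<in>ilace (Suc r) x \<times> {?u..x (Suc (Suc r))}. G (Suc (Suc r)) (ys @ [y]))"
    unfolding b sum_product sum.cartesian_product
    by (intro sum.cong refl) (auto simp: snoc len)
  also have "\<dots> = sum (G (Suc (Suc r))) ((\<lambda>(ys, y). ys @ [y]) ` (ilace (Suc r) x \<times> {?u..x (Suc (Suc r))}))"
    by (subst sum.reindex) (auto simp: inj_on_def case_prod_unfold)
  also have "\<dots> = block d a (Suc (Suc r)) x + sum (G (Suc (Suc r))) ((\<lambda>ys. ys @ [?u, ?u]) ` ilace r x)"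
    unfolding ilace_Suc_Suc[OF assms(1)] b using assms(2) disj
    by (simp add: sum.union_disjoint finite_ilace)
  also have "sum (G (Suc (Suc r))) ((\<lambda>ys. ys @ [?u, ?u]) ` ilace r x) = (\<Sum>ys\<in>ilace r x. G r ys * g r ?u * g (Suc r) ?u)"
  proof (subst sum.reindex)
    show "sum (G (Suc (Suc r)) \<circ> (\<lambda>ys. ys @ [?u, ?u])) (ilace r x) = (\<Sum>ys\<in>ilace r x. G r ys * g r ?u * g (Suc r) ?u)"
    proof (intro sum.cong refl)
      fix ys assume "ys \<in> ilace r x"
      then show "(G (Suc (Suc r)) \<circ> (\<lambda>ys. ys @ [?u, ?u])) ys = G r ys * g r ?u * g (Suc r) ?u"
        using snoc[of "ys @ [?u]" "Suc r" ?u] snoc[of ys r ?u] by (simp add: len)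
    qed
  qed (auto simp: inj_on_def)
  also have "\<dots> = block d a r x * g r ?u * g (Suc r) ?u"
    by (simp add: b sum_distrib_right)
  finally have *: "block d a (Suc r) x * (\<Sum>y=?u..x (Suc (Suc r)). g (Suc r) y) =
      block d a (Suc (Suc r)) x + block d a r x * g r ?u * g (Suc r) ?u" .
  have "(\<Sum>y=?u..x (Suc (Suc r)). g (Suc r) y) =
      emb (a + Suc r) (shift (int (x (Suc (Suc r))) - d + 1)) - emb (a + Suc r) (shift (int ?u - d))"
    unfolding g_def emb_sum[symmetric] sum_shift_telescope[OF assms(2)] emb_diff ..
  with * show ?thesis
    unfolding g_def by (simp only: eq_diff_eq)
qed

text \<open>What survives of \<open>block\<close> after telescoping: lower ends up to some index, upper ends from there on.\<close>

fun teleblock :: "int \<Rightarrow> nat \<Rightarrow> nat \<Rightarrow> (nat \<Rightarrow> nat) \<Rightarrow> mlaurent" where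
  "teleblock d a 0 x = 1"
| "teleblock d a (Suc r) x = teleblock d a r x * emb (a + r) (shift (int (x (Suc r)) - d + 1))
     + (\<Prod>p<Suc r. - emb (a + p) (shift (int (x p) - d)))"

lemma swp_teleblock: "a + r \<le> i \<Longrightarrow> swp i (teleblock d a r x) = teleblock d a r x"
  by (induction r)
     (simp_all add: ren_add ren_diff ren_mult ren_prod ren_uminus inj_transpose swp_emb_other)

lemma teleblock_sum:
  "teleblock d a r x = (\<Sum>i\<le>r. (\<Prod>p<i. - emb (a + p) (shift (int (x p) - d))) *
      (\<Prod>p\<in>{i..<r}. emb (a + p) (shift (int (x (Suc p)) - d + 1))))"
  by (induction r) (simp_all add: sum_distrib_right mult.assoc prod.atLeastLessThan_Suc)

lemma LamS_diff: "LamS k (P - Q) = LamS k P - LamS k Q"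
  and LamS_sum: "LamS k (\<Sum>i\<in>I. R i) = (\<Sum>i\<in>I. LamS k (R i))"
  and LamS_cmult_int: "LamS k (of_int c * P) = of_int c * LamS k P"
  by (simp_all add: LamS_def linext_diff linext_sum linext_cmult_int)

text \<open>Strong induction on \<open>r\<close>, since the recursion for \<open>block\<close> goes
  back by one and by two. \<open>Z\<close> is general so that it can absorb the factors in the
  variables split off.\<close>

lemma LamS_block:
  assumes "a + r \<le> k" "\<And>i. i < r \<Longrightarrow> x i < x (Suc i)"
    and "\<And>i. Suc i < r \<Longrightarrow> swp (a + i) Z = Z"
  shows "LamS k (nprod k * Z * block d a r x) = LamS k (nprod k * Z * teleblock d a r x)"
  using assms
proof (induction r arbitrary: Z rule: less_induct)
  case (less r)
  consider "r = 0" | "r = 1" | s where "r = Suc (Suc s)"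
    by (metis One_nat_def not0_implies_Suc)
  then show ?case
  proof cases
    case 1
    then show ?thesis by (simp add: block_0)
  next
    case 2
    then show ?thesis using less.prems(2)[of 0] by (simp add: block_1)
  next
    case (3 s)
    let ?u = "int (x (Suc s)) - d"
    let ?U = "emb (a + Suc s) (shift (int (x (Suc (Suc s))) - d + 1))"
    let ?L = "emb (a + Suc s) (shift ?u)"
    let ?g = "emb (a + s) (shift ?u * (shift 1 - 1)) * emb (a + Suc s) (shift ?u * (shift 1 - 1))"
    let ?e = "teleblock d a s x * emb (a + s) (shift ?u) * emb (a + Suc s) (shift ?u)"
    have x: "x s < x (Suc s)" "x (Suc s) < x (Suc (Suc s))"
      using less.prems(2) 3 by auto
    have IH1: "LamS k (nprod k * (Z * (?U - ?L)) * block d a (Suc s) x) =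
        LamS k (nprod k * (Z * (?U - ?L)) * teleblock d a (Suc s) x)"
      using less.prems 3
      by (intro less.IH) (auto simp: ren_mult ren_diff inj_transpose swp_emb_other)
    have IH2: "LamS k (nprod k * (Z * ?g) * block d a s x) = LamS k (nprod k * (Z * ?g) * teleblock d a s x)"
      using less.prems 3
      by (intro less.IH) (auto simp: ren_mult inj_transpose swp_emb_other)
    \<comment> \<open>Replacing \<open>block\<close> by \<open>teleblock\<close> in the recursion
      leaves a defect that is a multiple of \<open>nf (a + Suc s) (a + s)\<close>. Its cofactor
      \<open>?e\<close> is symmetric in the last two variables, as both carry the exponent
      \<open>?u\<close>; together with \<open>nprod k\<close> the defect is invariant under their
      exchange.\<close>
    have tele: "(?U - ?L) * teleblock d a (Suc s) x - ?g * teleblock d a s x =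
        teleblock d a r x - ?e * nf (a + Suc s) (a + s)"
      by (simp only: 3 nf_def teleblock.simps prod.lessThan_Suc emb_mult emb_diff emb_one shift_add)
         (simp add: algebra_simps)
    have "LamS k (nprod k * Z * block d a r x) =
        LamS k (nprod k * (Z * (?U - ?L)) * block d a (Suc s) x) - LamS k (nprod k * (Z * ?g) * block d a s x)"
      unfolding 3 block_Suc_Suc[of x s, OF x(1) less_imp_le[OF x(2)]] LamS_diff[symmetric]
      by (rule arg_cong[of _ _ "LamS k"]) (simp add: algebra_simps)
    also have "\<dots> = LamS k (nprod k * Z * ((?U - ?L) * teleblock d a (Suc s) x - ?g * teleblock d a s x))"
      unfolding IH1 IH2 LamS_diff[symmetric]
      by (rule arg_cong[of _ _ "LamS k"]) (simp only: algebra_simps)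
    also have "\<dots> = LamS k (nprod k * Z * teleblock d a r x) - LamS k (nprod k * nf (a + Suc s) (a + s) * (Z * ?e))"
      unfolding tele LamS_diff[symmetric]
      by (rule arg_cong[of _ _ "LamS k"]) (simp only: algebra_simps)
    also have "LamS k (nprod k * nf (a + Suc s) (a + s) * (Z * ?e)) = 0"
    proof (rule LamS_swp_invariant)
      show "Suc (a + s) < k" using less.prems 3 by simp
      have *: "swp (a + s) (P * (Q * R)) = swp (a + s) P * (swp (a + s) Q * swp (a + s) R)" for P Q R
        by (simp add: ren_mult inj_transpose)
      have "swp (a + s) ?e = ?e"
        by (simp add: ren_mult inj_transpose swp_teleblock swp_emb mult_ac)
      moreover have "swp (a + s) Z = Z" using less.prems(3)[of s] 3 by simp
      ultimately show "swp (a + s) (nprod k * nf (a + Suc s) (a + s) * (Z * ?e)) = nprod k * nf (a + Suc s) (a + s) * (Z * ?e)"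
        using swp_nprod[OF \<open>Suc (a + s) < k\<close>] by (simp only: * add_Suc_right)
    qed
    finally show ?thesis by simp
  qed
qed


lemma bethe_Suc_zero:
  assumes "\<And>i. i \<le> k \<Longrightarrow> ev1 (f i) = 0"
  shows "bethe (Suc k) f = 0"
  using assms by (simp add: bethe_laplace)

text \<open>One row of the triangle. The first \<open>a\<close> and the last
  \<open>k - a - r\<close> variables belong to columns that are no longer active; the
  \<open>r + 1\<close> variables between them are active, and \<open>r\<close> of them remain when
  the row is undone. By \<open>left\<close> and \<open>right\<close>, undoing it strips a factor
  \<open>1 - w\<close> or \<open>(w - 1) / w\<close> from each inactive column.\<close>

lemma bethe_step:
  assumes ark: "a + r \<le> k"
    and x: "\<And>i. i < r \<Longrightarrow> x i < x (Suc i)"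
    and left: "\<And>p. p < a \<Longrightarrow> f p = (1 - shift 1) * f' p"
    and mid: "\<And>i. i \<le> r \<Longrightarrow> f (a + i) = shift (int (x i) - d)"
    and right: "\<And>p. a + r \<le> p \<Longrightarrow> p < k \<Longrightarrow> f (Suc p) * shift 1 = (shift 1 - 1) * f' p"
  shows "bethe (Suc k) f = (\<Sum>ys\<in>ilace r x.
    bethe k (\<lambda>p. if a \<le> p \<and> p < a + r then shift (int (ys ! (p - a)) - d) else f' p))"
proof -
  \<comment> \<open>What the inactive columns contribute after the lift. These factors avoid the
    variables of the block, so they satisfy the symmetry condition of
    \<open>LamS_block\<close>.\<close>
  define Zl where "Zl = (\<Prod>p<a. emb p ((shift 1 - 1) * f' p))"
  define Zr where "Zr = (\<Prod>p\<in>{a + r..<k}. emb p ((shift 1 - 1) * f' p))"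
  have split: "prod F {..<k} = prod F {..<a} * (\<Prod>i<r. F (a + i)) * prod F {a + r..<k}" for F :: "nat \<Rightarrow> mlaurent"
  proof -
    have "prod F {..<k} = prod F {..<a} * (prod F {a..<a + r} * prod F {a + r..<k})"
      using ark by (simp add: prod.atLeastLessThan_concat lessThan_atLeast0)
    also have "prod F {a..<a + r} = (\<Prod>i<r. F (a + i))"
      by (simp add: prod.atLeastLessThan_shift_0[of _ a] lessThan_atLeast0 comp_def add.commute)
    finally show ?thesis by (simp add: mult_ac)
  qed
  have "bethe k (\<lambda>p. if a \<le> p \<and> p < a + r then shift (int (ys ! (p - a)) - d) else f' p) =
    LamS k (nprod k * (Zl * Zr) * (\<Prod>i<r. emb (a + i) (shift (int (ys ! i) - d) * (shift 1 - 1))))" for ys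
  proof -
    let ?h = "\<lambda>p. if a \<le> p \<and> p < a + r then shift (int (ys ! (p - a)) - d) else f' p"
    have "(\<Prod>p<k. emb p (?h p)) * nprod k * (\<Prod>p<k. emb p (shift 1 - 1)) =
      nprod k * (\<Prod>p<k. emb p (?h p * (shift 1 - 1)))"
      by (simp add: emb_mult prod.distrib mult_ac)
    also have "(\<Prod>p<k. emb p (?h p * (shift 1 - 1))) =
      Zl * (\<Prod>i<r. emb (a + i) (shift (int (ys ! i) - d) * (shift 1 - 1))) * Zr"
      unfolding split Zl_def Zr_def by (simp add: mult.commute)
    finally have eq: "(\<Prod>p<k. emb p (?h p)) * nprod k * (\<Prod>p<k. emb p (shift 1 - 1)) =
      nprod k * (Zl * (\<Prod>i<r. emb (a + i) (shift (int (ys ! i) - d) * (shift 1 - 1))) * Zr)" .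
    show ?thesis
      unfolding bethe_def LamS_lift[symmetric] eq by (simp add: mult_ac)
  qed
  then have "(\<Sum>ys\<in>ilace r x. bethe k (\<lambda>p. if a \<le> p \<and> p < a + r then shift (int (ys ! (p - a)) - d) else f' p)) =
    LamS k (nprod k * (Zl * Zr) * block d a r x)"
    by (simp add: block_def sum_distrib_left LamS_sum)
  also have "\<dots> = LamS k (nprod k * (Zl * Zr) * teleblock d a r x)"
  proof (rule LamS_block)
    show "a + r \<le> k" by (rule ark)
    show "x i < x (Suc i)" if "i < r" for i using that by (rule x)
    fix i assume "Suc i < r"
    then show "swp (a + i) (Zl * Zr) = Zl * Zr"
      unfolding Zl_def Zr_def
      by (auto simp: ren_mult[of _ "prod _ _"] inj_transpose ren_prod swp_emb_other
          intro!: arg_cong2[of _ _ _ _ "(*)"] prod.cong)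
  qed
  also have "\<dots> = (\<Sum>i\<le>r. (-1) ^ (a + i) * LamS k ((\<Prod>p<a + i. emb p (f p)) *
      (\<Prod>p\<in>{a + i..<k}. emb p (f (Suc p) * shift 1)) * nprod k))"
  proof -
    \<comment> \<open>Each term of \<open>teleblock_sum\<close> is a Laplace term of
      \<open>bethe (Suc k) f\<close>: lower ends keep their index, upper ends move down by one and
      take a \<open>shift 1\<close>. The sign collects \<open>a\<close> factors from
      \<open>1 - w = - (w - 1)\<close> and \<open>i\<close> from the negated lower ends.\<close>
    have "(\<Prod>p<i. - emb (a + p) (shift (int (x p) - d))) *
        (\<Prod>p\<in>{i..<r}. emb (a + p) (shift (int (x (Suc p)) - d + 1))) * (Zl * Zr) =
        of_int ((-1) ^ (a + i)) * ((\<Prod>p<a + i. emb p (f p)) * (\<Prod>p\<in>{a + i..<k}. emb p (f (Suc p) * shift 1)))"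
      if i: "i \<le> r" for i
    proof -
      have "(\<Prod>p<a + i. emb p (f p)) = (\<Prod>p<a. emb p (f p)) * (\<Prod>p\<in>{a..<a + i}. emb p (f p))"
        by (simp add: prod.atLeastLessThan_concat lessThan_atLeast0)
      also have "(\<Prod>p<a. emb p (f p)) = (-1) ^ a * Zl"
      proof -
        have "emb p (f p) = - 1 * emb p ((shift 1 - 1) * f' p)" if "p < a" for p
        proof -
          have "f p = - ((shift 1 - 1) * f' p)"
            unfolding left[OF that] by (simp add: algebra_simps)
          then show ?thesis by (simp only: emb_uminus) simp
        qed
        then have "(\<Prod>p<a. emb p (f p)) = (\<Prod>p<a. - 1 * emb p ((shift 1 - 1) * f' p))"
          by (intro prod.cong) auto
        then show ?thesis unfolding Zl_def prod.distrib by simp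
      qed
      also have "(\<Prod>p\<in>{a..<a + i}. emb p (f p)) = (\<Prod>p<i. emb (a + p) (shift (int (x p) - d)))"
        using i mid by (simp add: prod.atLeastLessThan_shift_0[of _ a] lessThan_atLeast0 comp_def add.commute)
      also have "\<dots> = (-1) ^ i * (\<Prod>p<i. - emb (a + p) (shift (int (x p) - d)))"
        by (simp add: prod_uminus flip: power_mult_distrib mult.assoc)
      finally have 1: "(\<Prod>p<a + i. emb p (f p)) =
        (-1) ^ a * Zl * ((-1) ^ i * (\<Prod>p<i. - emb (a + p) (shift (int (x p) - d))))" .
      have "(\<Prod>p\<in>{a + i..<k}. emb p (f (Suc p) * shift 1)) =
        (\<Prod>p\<in>{a + i..<a + r}. emb p (f (Suc p) * shift 1)) * (\<Prod>p\<in>{a + r..<k}. emb p (f (Suc p) * shift 1))"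
        using i ark by (simp add: prod.atLeastLessThan_concat)
      also have "(\<Prod>p\<in>{a + r..<k}. emb p (f (Suc p) * shift 1)) = Zr"
        unfolding Zr_def by (intro prod.cong refl) (simp add: right)
      also have "(\<Prod>p\<in>{a + i..<a + r}. emb p (f (Suc p) * shift 1)) =
        (\<Prod>p\<in>{i..<r}. emb (p + a) (f (Suc (p + a)) * shift 1))"
        using prod.shift_bounds_nat_ivl[of "\<lambda>p. emb p (f (Suc p) * shift 1)" i a r] by (simp add: add.commute)
      also have "\<dots> = (\<Prod>p\<in>{i..<r}. emb (a + p) (shift (int (x (Suc p)) - d + 1)))"
      proof (intro prod.cong refl)
        fix p assume "p \<in> {i..<r}"
        then have "f (Suc (p + a)) = shift (int (x (Suc p)) - d)"
          using mid[of "Suc p"] by (simp add: add.commute)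
        then show "emb (p + a) (f (Suc (p + a)) * shift 1) = emb (a + p) (shift (int (x (Suc p)) - d + 1))"
          by (simp only: shift_add add.commute mult.commute)
      qed
      finally have 2: "(\<Prod>p\<in>{a + i..<k}. emb p (f (Suc p) * shift 1)) =
        (\<Prod>p\<in>{i..<r}. emb (a + p) (shift (int (x (Suc p)) - d + 1))) * Zr" .
      have sg: "(-1) ^ a * ((-1) ^ a * Q) = Q" for Q :: mlaurent and a :: nat
        by (simp flip: mult.assoc power_mult_distrib)
      show ?thesis unfolding 1 2 by (simp add: power_add mult_ac sg)
    qed
    then have "nprod k * (Zl * Zr) * teleblock d a r x =
      (\<Sum>i\<le>r. of_int ((-1) ^ (a + i)) * ((\<Prod>p<a + i. emb p (f p)) *
        (\<Prod>p\<in>{a + i..<k}. emb p (f (Suc p) * shift 1)) * nprod k))"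
      unfolding teleblock_sum sum_distrib_left
      by (intro sum.cong refl) (simp add: mult_ac)
    then show ?thesis
      by (simp only: LamS_sum LamS_cmult_int) simp
  qed
  also have "\<dots> = (\<Sum>i\<in>(+) a ` {..r}. (-1) ^ i * LamS k ((\<Prod>p<i. emb p (f p)) *
      (\<Prod>p\<in>{i..<k}. emb p (f (Suc p) * shift 1)) * nprod k))"
    by (subst sum.reindex) (simp_all add: comp_def)
  \<comment> \<open>Laplace terms that delete an inactive column vanish, since there
    \<open>f i\<close> is zero at \<open>w = 1\<close>; for active columns
    \<open>ev1 (f i) = 1\<close>.\<close>
  also have "\<dots> = (\<Sum>i\<le>k. (-1) ^ i * of_int (ev1 (f i)) *
     LamS k ((\<Prod>p<i. emb p (f p)) * (\<Prod>p\<in>{i..<k}. emb p (f (Suc p) * shift 1)) * nprod k))"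
  proof (rule sum.mono_neutral_cong_left)
    show "\<forall>i\<in>{..k} - (+) a ` {..r}. (-1) ^ i * of_int (ev1 (f i)) *
       LamS k ((\<Prod>p<i. emb p (f p)) * (\<Prod>p\<in>{i..<k}. emb p (f (Suc p) * shift 1)) * nprod k) = 0"
    proof
      fix i assume i: "i \<in> {..k} - (+) a ` {..r}"
      then consider "i < a" | "i > a + r"
        by (metis DiffE atMost_iff image_eqI le_add_diff_inverse le_diff_conv linorder_not_less add.commute)
      then have "ev1 (f i) = 0"
      proof cases
        case 1
        then show ?thesis using left[of i] by (simp add: ev1_mult ev1_diff)
      next
        case 2
        then have "ev1 (f (Suc (i - 1)) * shift 1) = ev1 ((shift 1 - 1) * f' (i - 1))"
          using right[of "i - 1"] i by (intro arg_cong[of _ _ ev1]) auto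
        then show ?thesis using 2 by (simp add: ev1_mult ev1_diff)
      qed
      then show "(-1) ^ i * of_int (ev1 (f i)) *
       LamS k ((\<Prod>p<i. emb p (f p)) * (\<Prod>p\<in>{i..<k}. emb p (f (Suc p) * shift 1)) * nprod k) = 0" by simp
    qed
  qed (use ark mid in auto)
  finally show ?thesis by (simp add: bethe_laplace)
qed

section \<open>Alternation and partial sums\<close>

text \<open>A sequence alternating from 1 on has partial sum 1 while its last non-zero entry is 1,
  and 0 otherwise; the induction on \<open>h\<close> carries this last entry along.\<close>

lemma alternates_prefix_last:
  fixes f :: "nat \<Rightarrow> int"
  assumes "\<And>x. x \<in> {lo..<hi} \<Longrightarrow> f x \<in> {0, 1, -1}" "alternates_on {lo..<hi} f"
    and "\<And>x. x \<in> {lo..<hi} \<Longrightarrow> f x \<noteq> 0 \<Longrightarrow> (\<forall>z\<in>{lo..<hi}. z < x \<longrightarrow> f z = 0) \<Longrightarrow> f x = 1"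
    and "h \<le> hi"
  shows "sum f {lo..<h} = (if \<exists>x\<in>{lo..<h}. f x = 1 \<and> (\<forall>z\<in>{x<..<h}. f z = 0) then 1 else 0)"
  using assms(4)
proof (induction h)
  case (Suc h)
  show ?case
  proof (cases "lo \<le> h")
    case lo: True
    have sum: "sum f {lo..<Suc h} = sum f {lo..<h} + f h" using lo by simp
    have fh: "f h \<in> {0, 1, -1}" using assms(1)[of h] lo Suc.prems by simp
    show ?thesis
    proof (cases "f h = 0")
      case True
      then have "(\<exists>x\<in>{lo..<Suc h}. f x = 1 \<and> (\<forall>z\<in>{x<..<Suc h}. f z = 0)) \<longleftrightarrow>
          (\<exists>x\<in>{lo..<h}. f x = 1 \<and> (\<forall>z\<in>{x<..<h}. f z = 0))"
      proof -
        have "x \<in> {lo..<Suc h} \<and> f x = 1 \<and> (\<forall>z\<in>{x<..<Suc h}. f z = 0) \<longleftrightarrow>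
            x \<in> {lo..<h} \<and> f x = 1 \<and> (\<forall>z\<in>{x<..<h}. f z = 0)" for x
          using True by (cases "x = h") (auto simp: less_Suc_eq)
        then show ?thesis by blast
      qed
      then show ?thesis using Suc True sum by simp
    next
      case nz: False
      let ?last = "\<exists>x\<in>{lo..<h}. f x = 1 \<and> (\<forall>z\<in>{x<..<h}. f z = 0)"
      show ?thesis
      proof (cases "\<forall>z\<in>{lo..<h}. f z = 0")
        case True
        then have "f h = 1"
          using assms(3)[of h] nz lo Suc.prems by auto
        moreover have "sum f {lo..<h} = 0" using True by simp
        ultimately show ?thesis using sum lo by auto
      next
        case False
        define x where "x = Max {z \<in> {lo..<h}. f z \<noteq> 0}"
        have "x \<in> {z \<in> {lo..<h}. f z \<noteq> 0}"
          unfolding x_def using False by (intro Max_in) auto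
        then have x: "lo \<le> x" "x < h" "f x \<noteq> 0" by auto
        have zero: "f z = 0" if "x < z" "z < h" for z
        proof (rule ccontr)
          assume "f z \<noteq> 0"
          then have "z \<le> x" unfolding x_def using that x by (intro Max_ge) auto
          then show False using that by simp
        qed
        have "sgn (f h) = - sgn (f x)"
          using assms(2) x zero nz lo Suc.prems unfolding alternates_on_def by auto
        moreover have "f x \<in> {1, -1}" using assms(1)[of x] x Suc.prems by auto
        ultimately have fx: "f x = - f h" using fh nz by auto
        have "?last \<longleftrightarrow> f x = 1"
        proof
          assume ?last
          then obtain y where y: "y \<in> {lo..<h}" "f y = 1" "\<forall>z\<in>{y<..<h}. f z = 0" by blast
          then have "y = x" using x zero by (metis atLeastLessThan_iff greaterThanLessThan_iff linorder_neqE_nat zero_neq_one)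
          then show "f x = 1" using y by simp
        qed (use x zero in auto)
        moreover have "(\<exists>x\<in>{lo..<Suc h}. f x = 1 \<and> (\<forall>z\<in>{x<..<Suc h}. f z = 0)) \<longleftrightarrow> f h = 1"
        proof
          assume "f h = 1"
          then show "\<exists>x\<in>{lo..<Suc h}. f x = 1 \<and> (\<forall>z\<in>{x<..<Suc h}. f z = 0)"
            using lo by (intro bexI[of _ h]) auto
        qed (use nz lo in \<open>auto simp: less_Suc_eq\<close>)
        ultimately show ?thesis using sum fx fh nz Suc by auto
      qed
    qed
  qed simp
qed simp

text \<open>Moves between the values 0 and 1, starting at 0, are exactly the alternating sequences
  of steps 1 and -1 that begin with 1. This is the form of the column condition.\<close>

lemma alternates_iff_prefix_sums:
  fixes f :: "nat \<Rightarrow> int"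
  shows "(\<forall>x\<in>{lo..<hi}. f x \<in> {0, 1, -1}) \<and> alternates_on {lo..<hi} f \<and>
     (\<forall>x\<in>{lo..<hi}. f x \<noteq> 0 \<and> (\<forall>z\<in>{lo..<hi}. z < x \<longrightarrow> f z = 0) \<longrightarrow> f x = 1)
   \<longleftrightarrow> (\<forall>h\<le>hi. sum f {lo..<h} \<in> {0, 1})" (is "?A \<longleftrightarrow> ?B")
proof
  assume ?A
  then show ?B
    using alternates_prefix_last[of lo hi f] by (auto split: if_splits)
next
  assume B: ?B
  have step: "sum f {lo..<Suc x} = sum f {lo..<x} + f x" if "x \<in> {lo..<hi}" for x
    using that by simp
  have vals: "f x \<in> {0, 1, -1}" if "x \<in> {lo..<hi}" for x
  proof -
    have "sum f {lo..<x} \<in> {0, 1}" "sum f {lo..<Suc x} \<in> {0, 1}"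
      using B[rule_format, of x] B[rule_format, of "Suc x"] that by (simp_all del: sum.op_ivl_Suc)
    then show ?thesis using step[OF that] by auto
  qed
  have "sgn (f y) = - sgn (f x)"
    if xy: "x \<in> {lo..<hi}" "y \<in> {lo..<hi}" "x < y" "f x \<noteq> 0" "f y \<noteq> 0"
      "\<forall>z\<in>{lo..<hi}. x < z \<and> z < y \<longrightarrow> f z = 0" for x y
  proof -
    have "sum f {lo..<y} = sum f {lo..<Suc x} + sum f {Suc x..<y}"
      using sum.atLeastLessThan_concat[of lo "Suc x" y f] xy by (simp del: sum.op_ivl_Suc)
    also have "sum f {Suc x..<y} = 0"
      using xy by (intro sum.neutral) auto
    finally have 1: "sum f {lo..<y} = sum f {lo..<x} + f x"
      using step[OF xy(1)] by simp
    have "sum f {lo..<x} \<in> {0, 1}" "sum f {lo..<y} \<in> {0, 1}" "sum f {lo..<Suc y} \<in> {0, 1}"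
      using B[rule_format, of x] B[rule_format, of y] B[rule_format, of "Suc y"] xy
      by (simp_all del: sum.op_ivl_Suc)
    then show ?thesis using 1 step[OF xy(2)] xy(4,5) by auto
  qed
  then have "alternates_on {lo..<hi} f" unfolding alternates_on_def by blast
  moreover have "f x = 1" if x: "x \<in> {lo..<hi}" "f x \<noteq> 0" "\<forall>z\<in>{lo..<hi}. z < x \<longrightarrow> f z = 0" for x
  proof -
    have "sum f {lo..<x} = 0" using x by (intro sum.neutral) auto
    then have "sum f {lo..<Suc x} = f x" using step[OF x(1)] by simp
    moreover have "sum f {lo..<Suc x} \<in> {0, 1}"
      using B[rule_format, of "Suc x"] x by (simp del: sum.op_ivl_Suc)
    ultimately show ?thesis using x(2) by auto
  qed
  ultimately show ?A using vals by blast
qed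

text \<open>The form of the row condition: total 1 forces the first non-zero entry to be 1. Were it
  -1, the negated row would satisfy the column condition and have total 0 or 1, whereas its total is
  -1.\<close>

lemma alternates_total_one_iff:
  fixes f :: "nat \<Rightarrow> int"
  shows "(\<forall>x\<in>{lo..<hi}. f x \<in> {0, 1, -1}) \<and> alternates_on {lo..<hi} f \<and> sum f {lo..<hi} = 1
   \<longleftrightarrow> (\<forall>h\<le>hi. sum f {lo..<h} \<in> {0, 1}) \<and> sum f {lo..<hi} = 1"
proof
  assume A: "(\<forall>x\<in>{lo..<hi}. f x \<in> {0, 1, -1}) \<and> alternates_on {lo..<hi} f \<and> sum f {lo..<hi} = 1"
  have "f x = 1" if x: "x \<in> {lo..<hi}" "f x \<noteq> 0" "\<forall>z\<in>{lo..<hi}. z < x \<longrightarrow> f z = 0" for x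
  proof (rule ccontr)
    assume "f x \<noteq> 1"
    then have fx: "f x = -1" using A x by auto
    have "(\<forall>x\<in>{lo..<hi}. - f x \<in> {0, 1, -1}) \<and> alternates_on {lo..<hi} (\<lambda>x. - f x) \<and>
        (\<forall>y\<in>{lo..<hi}. - f y \<noteq> 0 \<and> (\<forall>z\<in>{lo..<hi}. z < y \<longrightarrow> - f z = 0) \<longrightarrow> - f y = 1)"
    proof (intro conjI ballI impI)
      show "- f y \<in> {0, 1, -1}" if "y \<in> {lo..<hi}" for y using A that by auto
      show "alternates_on {lo..<hi} (\<lambda>x. - f x)"
        using A unfolding alternates_on_def by (auto simp: sgn_minus)
      fix y assume "y \<in> {lo..<hi}" "- f y \<noteq> 0 \<and> (\<forall>z\<in>{lo..<hi}. z < y \<longrightarrow> - f z = 0)"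
      then have "y = x" using x by (metis linorder_neqE_nat neg_equal_0_iff_equal)
      then show "- f y = 1" using fx by simp
    qed
    then have "sum (\<lambda>x. - f x) {lo..<hi} \<in> {0, 1}"
      using alternates_iff_prefix_sums[of lo hi "\<lambda>x. - f x"] by blast
    then show False using A by (auto simp: sum_negf)
  qed
  then show "(\<forall>h\<le>hi. sum f {lo..<h} \<in> {0, 1}) \<and> sum f {lo..<hi} = 1"
    using A alternates_iff_prefix_sums[of lo hi f] by blast
next
  assume "(\<forall>h\<le>hi. sum f {lo..<h} \<in> {0, 1}) \<and> sum f {lo..<hi} = 1"
  then show "(\<forall>x\<in>{lo..<hi}. f x \<in> {0, 1, -1}) \<and> alternates_on {lo..<hi} f \<and> sum f {lo..<hi} = 1"
    using alternates_iff_prefix_sums[of lo hi f] by blast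
qed

section \<open>Truncated triangles in terms of partial sums\<close>

definition partial_AST :: "nat \<Rightarrow> nat \<Rightarrow> (nat \<Rightarrow> nat \<Rightarrow> int) \<Rightarrow> bool" where
  "partial_AST n k a \<longleftrightarrow>
     (\<forall>i c. \<not> (i \<in> {1..k} \<and> c \<in> row_cols n i) \<longrightarrow> a i c = 0) \<and>
     (\<forall>i\<in>{1..k}. (\<forall>c. sum (a i) {..<c} \<in> {0, 1}) \<and> sum (a i) {..2 * n} = 1) \<and>
     (\<forall>c. \<forall>i\<le>k. (\<Sum>i'=1..i. a i' c) \<in> {0, 1})"

definition one_cols :: "nat \<Rightarrow> (nat \<Rightarrow> nat \<Rightarrow> int) \<Rightarrow> nat set" where
  "one_cols k a = {c. (\<Sum>i=1..k. a i c) = 1}"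

lemma sum_lessThan_eq_from:
  fixes f :: "nat \<Rightarrow> int"
  assumes "\<And>x. x < lo \<Longrightarrow> f x = 0"
  shows "sum f {..<h} = sum f {lo..<h}"
  by (rule sum.mono_neutral_right) (use assms in auto)

lemma sum_from_beyond:
  fixes f :: "nat \<Rightarrow> int"
  assumes "\<And>x. x \<ge> hi \<Longrightarrow> f x = 0" "hi \<le> h"
  shows "sum f {lo..<h} = sum f {lo..<hi}"
  by (rule sum.mono_neutral_right) (use assms in auto)

lemma prefix_sums_outside:
  fixes f :: "nat \<Rightarrow> int"
  assumes "\<And>x. x \<notin> {lo..<hi} \<Longrightarrow> f x = 0"
  shows "(\<forall>h\<le>hi. sum f {lo..<h} \<in> A) \<longleftrightarrow> (\<forall>h. sum f {..<h} \<in> A)"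
proof -
  have "sum f {..<h} = sum f {lo..<min h hi}" for h
    using sum_lessThan_eq_from[of lo f h] sum_from_beyond[of hi f h lo] assms
    by (cases "h \<le> hi") (simp_all add: min_def)
  then show ?thesis by (metis min.absorb1 min.cobounded2)
qed

text \<open>Entries outside the triangle are 0, so partial sums within a row or column of the
  triangle can be replaced by sums over all smaller indices.\<close>

lemma is_AST_iff_partial_AST:
  assumes "n \<ge> 1"
  shows "is_AST n a \<longleftrightarrow> partial_AST n n a"
proof -
  define Z where "Z \<longleftrightarrow> (\<forall>i c. \<not> (i \<in> {1..n} \<and> c \<in> row_cols n i) \<longrightarrow> a i c = 0)"
  have rows: "(\<forall>c\<in>row_cols n i. a i c \<in> {0, 1, -1}) \<and> alternates_on (row_cols n i) (a i) \<and>
      (\<Sum>c\<in>row_cols n i. a i c) = 1 \<longleftrightarrow> (\<forall>c. sum (a i) {..<c} \<in> {0, 1}) \<and> sum (a i) {..2 * n} = 1"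
    if Z "i \<in> {1..n}" for i
  proof -
    have rc: "row_cols n i = {i..<Suc (2 * n - i)}" by (auto simp: row_cols_def)
    have z: "a i c = 0" if "c \<notin> {i..<Suc (2 * n - i)}" for c
      using \<open>Z\<close> that rc unfolding Z_def by blast
    have "sum (a i) {..2 * n} = sum (a i) {i..<Suc (2 * n - i)}"
      by (rule sum.mono_neutral_right) (use z in auto)
    then show ?thesis
      unfolding rc alternates_total_one_iff using prefix_sums_outside[of i "Suc (2 * n - i)" "a i" "{0, 1}"] z by auto
  qed
  have cols: "(\<forall>i\<in>col_rows n c. a i c \<in> {0, 1, -1}) \<and> alternates_on (col_rows n c) (\<lambda>i. a i c) \<and>
      (\<forall>i\<in>col_rows n c. a i c \<noteq> 0 \<and> (\<forall>k\<in>col_rows n c. k < i \<longrightarrow> a k c = 0) \<longrightarrow> a i c = 1) \<longleftrightarrow>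
      (\<forall>i\<le>n. (\<Sum>i'=1..i. a i' c) \<in> {0, 1})"
    if Z "c \<in> {1..2 * n - 1}" for c
  proof -
    have cr: "col_rows n c = {1..<Suc (min c (2 * n - c))}"
      using that(2) by (auto simp: col_rows_def row_cols_def)
    have z: "a i c = 0" if "i \<notin> {1..<Suc (min c (2 * n - c))}" for i
      using \<open>Z\<close> that cr unfolding Z_def col_rows_def by blast
    have "(\<forall>h. sum (\<lambda>i. a i c) {..<h} \<in> {0, 1}) \<longleftrightarrow> (\<forall>i\<le>n. (\<Sum>i'=1..i. a i' c) \<in> {0, 1})"
    proof -
      have "(\<Sum>i'=1..i. a i' c) = (\<Sum>i'<Suc i. a i' c)" for i
        by (rule sum.mono_neutral_left) (use z in auto)
      \<comment> \<open>Nothing is added beyond row \<open>n\<close>. For \<open>h = 0\<close> the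
        truncated subtraction leaves the prefix consisting of row 0, which is zero.\<close>
      moreover have "(\<Sum>i'<h. a i' c) = (\<Sum>i'<Suc (min (h - 1) n). a i' c)" for h
        by (rule sum.mono_neutral_cong) (use z in auto)
      ultimately show ?thesis by (metis min.cobounded2)
    qed
    then show ?thesis
      unfolding cr alternates_iff_prefix_sums
      using prefix_sums_outside[of 1 "Suc (min c (2 * n - c))" "\<lambda>i. a i c" "{0, 1}"] z by simp
  qed
  have out: "(\<Sum>i'=1..i. a i' c) \<in> {0, 1}" if Z "c \<notin> {1..2 * n - 1}" for c i
  proof -
    have "c \<notin> row_cols n i'" if "i' \<ge> 1" for i'
      using \<open>c \<notin> _\<close> that by (auto simp: row_cols_def)
    then have "(\<Sum>i'=1..i. a i' c) = 0"
      using \<open>Z\<close> unfolding Z_def by (intro sum.neutral) auto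
    then show ?thesis by simp
  qed
  have vals: "(\<forall>c\<in>{1..2 * n - 1}. \<forall>i\<in>col_rows n c. a i c \<in> {0, 1, -1})"
    if "\<forall>i\<in>{1..n}. \<forall>c\<in>row_cols n i. a i c \<in> {0, 1, -1}"
    using that unfolding col_rows_def by blast
  show ?thesis
  proof
    assume A: "is_AST n a"
    then have Z by (simp add: is_AST_def Z_def)
    have "(\<forall>c. sum (a i) {..<c} \<in> {0, 1}) \<and> sum (a i) {..2 * n} = 1" if "i \<in> {1..n}" for i
      using rows[OF \<open>Z\<close> that] A that unfolding is_AST_def by blast
    moreover have "(\<Sum>i'=1..i. a i' c) \<in> {0, 1}" if "i \<le> n" for c i
    proof (cases "c \<in> {1..2 * n - 1}")
      case True
      then show ?thesis using cols[OF \<open>Z\<close> True] A that vals unfolding is_AST_def by blast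
    qed (use out \<open>Z\<close> in blast)
    ultimately show "partial_AST n n a"
      using \<open>Z\<close> unfolding partial_AST_def Z_def by blast
  next
    assume A: "partial_AST n n a"
    then have Z by (simp add: partial_AST_def Z_def)
    have r: "(\<forall>c\<in>row_cols n i. a i c \<in> {0, 1, -1}) \<and> alternates_on (row_cols n i) (a i) \<and>
      (\<Sum>c\<in>row_cols n i. a i c) = 1" if "i \<in> {1..n}" for i
      using rows[OF \<open>Z\<close> that] A that unfolding partial_AST_def by blast
    have c: "alternates_on (col_rows n c) (\<lambda>i. a i c) \<and>
      (\<forall>i\<in>col_rows n c. a i c \<noteq> 0 \<and> (\<forall>k\<in>col_rows n c. k < i \<longrightarrow> a k c = 0) \<longrightarrow> a i c = 1)"
      if "c \<in> {1..2 * n - 1}" for c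
      using cols[OF \<open>Z\<close> that] A unfolding partial_AST_def by blast
    show "is_AST n a"
      using r c \<open>Z\<close> unfolding is_AST_def Z_def by blast
  qed
qed

section \<open>Chains of interlacing sets\<close>

text \<open>\<open>S\<close> is the set after row \<open>i\<close> and \<open>T\<close> the set
  before it. Row \<open>i\<close> is the difference of their indicator functions, so its partial
  sums are differences of counts, and the last conjunct makes its total 1.\<close>

definition row_step :: "nat \<Rightarrow> nat \<Rightarrow> nat set \<Rightarrow> nat set \<Rightarrow> bool" where
  "row_step n i S T \<longleftrightarrow> finite T \<and> (\<forall>c. c \<notin> row_cols n i \<longrightarrow> (c \<in> S \<longleftrightarrow> c \<in> T)) \<and>
     (\<forall>c. int (card (S \<inter> {..<c})) - int (card (T \<inter> {..<c})) \<in> {0, 1}) \<and> card S = Suc (card T)"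

fun nchains :: "nat \<Rightarrow> nat \<Rightarrow> nat set \<Rightarrow> nat" where
  "nchains n 0 S = (if S = {} then 1 else 0)"
| "nchains n (Suc k) S = (\<Sum>T\<in>{T. row_step n (Suc k) S T}. nchains n k T)"

lemma row_step_subset:
  assumes "row_step n i S T" "i \<ge> 1" "S \<subseteq> {1..2 * n - 1}"
  shows "T \<subseteq> {1..2 * n - 1}"
proof
  fix c assume "c \<in> T"
  then have "c \<in> S \<or> c \<in> row_cols n i" using assms(1) unfolding row_step_def by blast
  then show "c \<in> {1..2 * n - 1}" using assms(2,3) by (auto simp: row_cols_def)
qed

lemma finite_row_step:
  assumes "i \<ge> 1" "S \<subseteq> {1..2 * n - 1}"
  shows "finite {T. row_step n i S T}"
  by (rule finite_subset[of _ "Pow {1..2 * n - 1}"]) (use row_step_subset[OF _ assms] in auto)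

lemma one_cols_subset:
  assumes "partial_AST n k a"
  shows "one_cols k a \<subseteq> {1..2 * n - 1}"
proof
  fix c assume c: "c \<in> one_cols k a"
  show "c \<in> {1..2 * n - 1}"
  proof (rule ccontr)
    assume "c \<notin> {1..2 * n - 1}"
    then have "c \<notin> row_cols n i" if "i \<ge> 1" for i using that by (auto simp: row_cols_def)
    then have "(\<Sum>i=1..k. a i c) = 0"
      using assms unfolding partial_AST_def by (intro sum.neutral) auto
    then show False using c by (simp add: one_cols_def)
  qed
qed

lemma col_sum_eq:
  assumes "partial_AST n k a"
  shows "(\<Sum>i=1..k. a i c) = of_bool (c \<in> one_cols k a)"
proof -
  have "(\<Sum>i=1..k. a i c) \<in> {0, 1}" using assms unfolding partial_AST_def by blast
  then show ?thesis by (auto simp: one_cols_def)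
qed

lemma sum_of_bool_diff:
  assumes "finite A"
  shows "(\<Sum>c\<in>A. of_bool (c \<in> S) - of_bool (c \<in> T)) = int (card (S \<inter> A)) - int (card (T \<inter> A))"
  using assms by (simp add: sum_subtractf of_bool_def sum.If_cases Int_commute)

text \<open>Column sums are 0 or 1, so a row is recovered as the difference of the indicators of the
  sets of 1-columns after and before it.\<close>

lemma partial_AST_restrict:
  assumes "partial_AST n (Suc k) a"
  shows "partial_AST n k (a(Suc k := \<lambda>_. 0))"
    and "one_cols k (a(Suc k := \<lambda>_. 0)) = one_cols k a"
    and "a (Suc k) c = of_bool (c \<in> one_cols (Suc k) a) - of_bool (c \<in> one_cols k a)"
proof -
  have eq: "(\<Sum>i'=1..i. (a(Suc k := \<lambda>_. 0)) i' c) = (\<Sum>i'=1..i. a i' c)" if "i \<le> k" for i c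
    using that by (intro sum.cong) auto
  show "one_cols k (a(Suc k := \<lambda>_. 0)) = one_cols k a"
    unfolding one_cols_def by (simp only: eq[OF order_refl])
  show "partial_AST n k (a(Suc k := \<lambda>_. 0))"
    unfolding partial_AST_def
  proof (intro conjI allI impI ballI)
    fix i c assume "i \<le> k"
    then show "(\<Sum>i'=1..i. (a(Suc k := \<lambda>_. 0)) i' c) \<in> {0, 1}"
      unfolding eq[OF \<open>i \<le> k\<close>] using assms unfolding partial_AST_def by (meson le_SucI)
  qed (use assms in \<open>auto simp: partial_AST_def\<close>)
  have "(\<Sum>i=1..k. a i c) \<in> {0, 1}"
    using assms unfolding partial_AST_def by (meson le_SucI order_refl)
  then have "(\<Sum>i=1..k. a i c) = of_bool (c \<in> one_cols k a)" by (auto simp: one_cols_def)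
  then show "a (Suc k) c = of_bool (c \<in> one_cols (Suc k) a) - of_bool (c \<in> one_cols k a)"
    using col_sum_eq[OF assms, of c] by simp
qed

lemma row_step_one_cols:
  assumes "partial_AST n (Suc k) a"
  shows "row_step n (Suc k) (one_cols (Suc k) a) (one_cols k a)"
proof -
  let ?S = "one_cols (Suc k) a" and ?T = "one_cols k a"
  note r = partial_AST_restrict[OF assms]
  have sub: "?S \<subseteq> {1..2 * n - 1}" "?T \<subseteq> {1..2 * n - 1}"
    using one_cols_subset[OF assms] one_cols_subset[OF r(1)] r(2) by auto
  have pre: "sum (a (Suc k)) A = int (card (?S \<inter> A)) - int (card (?T \<inter> A))" if "finite A" for A
    using sum_of_bool_diff[OF that, of ?S ?T] by (simp add: r(3) cong: sum.cong)
  have "{1..2 * n - 1} \<subseteq> {..2 * n}" by auto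
  then have "?S \<inter> {..2 * n} = ?S" "?T \<inter> {..2 * n} = ?T" using sub by blast+
  moreover have "sum (a (Suc k)) {..2 * n} = 1" "\<forall>c. sum (a (Suc k)) {..<c} \<in> {0, 1}"
    using assms unfolding partial_AST_def by auto
  moreover have "c \<in> ?S \<longleftrightarrow> c \<in> ?T" if "c \<notin> row_cols n (Suc k)" for c
  proof -
    have "a (Suc k) c = 0" using assms that unfolding partial_AST_def by blast
    then show ?thesis using r(3)[of c] by (auto split: if_splits)
  qed
  moreover have "finite ?T" using sub(2) finite_subset by blast
  ultimately show ?thesis
    unfolding row_step_def by (auto simp: pre)
qed

lemma partial_AST_extend:
  fixes a :: "nat \<Rightarrow> nat \<Rightarrow> int"
  assumes "partial_AST n k a" "row_step n (Suc k) S (one_cols k a)" "S \<subseteq> {1..2 * n - 1}"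
  defines "b \<equiv> a(Suc k := \<lambda>c. of_bool (c \<in> S) - of_bool (c \<in> one_cols k a))"
  shows "partial_AST n (Suc k) b" "one_cols (Suc k) b = S"
proof -
  let ?T = "one_cols k a"
  have T: "?T \<subseteq> {1..2 * n - 1}" by (rule one_cols_subset[OF assms(1)])
  have eq: "(\<Sum>i'=1..i. b i' c) = (\<Sum>i'=1..i. a i' c)" if "i \<le> k" for i c
    using that unfolding b_def by (intro sum.cong) auto
  have top: "(\<Sum>i=1..Suc k. b i c) = of_bool (c \<in> S)" for c
    using eq[of k c] col_sum_eq[OF assms(1), of c] by (simp add: b_def)
  show "one_cols (Suc k) b = S"
    unfolding one_cols_def top by auto
  have pre: "sum (b (Suc k)) A = int (card (S \<inter> A)) - int (card (?T \<inter> A))" if "finite A" for A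
    unfolding b_def using sum_of_bool_diff[OF that, of S ?T] by simp
  have "{1..2 * n - 1} \<subseteq> {..2 * n}" by auto
  then have "S \<inter> {..2 * n} = S" "?T \<inter> {..2 * n} = ?T" using assms(3) T by blast+
  then have tot: "sum (b (Suc k)) {..2 * n} = 1"
    using assms(2) by (simp add: pre row_step_def)
  have low: "b i = a i" if "i \<le> k" for i using that by (simp add: b_def)
  show "partial_AST n (Suc k) b"
    unfolding partial_AST_def
  proof (intro conjI allI impI ballI)
    fix i c assume ic: "\<not> (i \<in> {1..Suc k} \<and> c \<in> row_cols n i)"
    show "b i c = 0"
    proof (cases "i = Suc k")
      case True
      then have "c \<in> S \<longleftrightarrow> c \<in> ?T" using ic assms(2) unfolding row_step_def by auto
      then show ?thesis using True by (simp add: b_def)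
    next
      case False
      then have "\<not> (i \<in> {1..k} \<and> c \<in> row_cols n i)" using ic by auto
      then show ?thesis using False assms(1) unfolding partial_AST_def b_def by auto
    qed
  next
    fix i c assume i: "i \<in> {1..Suc k}"
    show "sum (b i) {..<c} \<in> {0, 1}"
    proof (cases "i = Suc k")
      case True
      then show ?thesis using assms(2) by (simp add: pre row_step_def)
    next
      case False
      then show ?thesis using i assms(1) low[of i] unfolding partial_AST_def by auto
    qed
    show "sum (b i) {..2 * n} = 1"
    proof (cases "i = Suc k")
      case False
      then show ?thesis using i assms(1) low[of i] unfolding partial_AST_def by auto
    qed (use tot in simp)
  next
    fix c i assume "i \<le> Suc k"
    then consider "i \<le> k" | "i = Suc k" by linarith
    then show "(\<Sum>i'=1..i. b i' c) \<in> {0, 1}"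
    proof cases
      case 1
      then show ?thesis unfolding eq[OF 1] using assms(1) unfolding partial_AST_def by blast
    next
      case 2
      then show ?thesis unfolding 2 top by auto
    qed
  qed
qed

text \<open>Deleting the last row is a bijection onto the truncated triangles over all admissible
  previous sets; the inverse \<open>?g\<close> restores the row from the two sets.\<close>

lemma card_partial_AST:
  assumes "S \<subseteq> {1..2 * n - 1}"
  shows "finite {a. partial_AST n k a \<and> one_cols k a = S} \<and>
    card {a. partial_AST n k a \<and> one_cols k a = S} = nchains n k S"
  using assms
proof (induction k arbitrary: S)
  case 0
  have "partial_AST n 0 a \<longleftrightarrow> a = (\<lambda>_ _. 0)" for a
    by (auto simp: partial_AST_def fun_eq_iff)
  moreover have "one_cols 0 a = {}" for a by (simp add: one_cols_def)
  ultimately have "{a. partial_AST n 0 a \<and> one_cols 0 a = S} = (if S = {} then {\<lambda>_ _. 0} else {})"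
    by auto
  then show ?case by simp
next
  case (Suc k)
  let ?B = "\<lambda>T. {a. partial_AST n k a \<and> one_cols k a = T}"
  let ?A = "{a. partial_AST n (Suc k) a \<and> one_cols (Suc k) a = S}"
  let ?f = "\<lambda>a :: nat \<Rightarrow> nat \<Rightarrow> int. a(Suc k := \<lambda>_. 0)"
  let ?g = "\<lambda>a :: nat \<Rightarrow> nat \<Rightarrow> int. a(Suc k := \<lambda>c. of_bool (c \<in> S) - of_bool (c \<in> one_cols k a))"
  have B: "finite (?B T) \<and> card (?B T) = nchains n k T" if "row_step n (Suc k) S T" for T
    using Suc.IH row_step_subset[OF that _ Suc.prems] by simp
  have fin: "finite {T. row_step n (Suc k) S T}"
    using finite_row_step[OF _ Suc.prems] by simp
  have bij: "bij_betw ?f ?A (\<Union>T\<in>{T. row_step n (Suc k) S T}. ?B T)"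
  proof (rule bij_betw_byWitness[of _ ?g])
    show "\<forall>a\<in>?A. ?g (?f a) = a"
    proof
      fix a assume "a \<in> ?A"
      then have a: "partial_AST n (Suc k) a" "one_cols (Suc k) a = S" by auto
      show "?g (?f a) = a"
        unfolding partial_AST_restrict(2)[OF a(1)]
        using partial_AST_restrict(3)[OF a(1)] a(2) by (auto simp: fun_eq_iff)
    qed
    show "\<forall>a\<in>(\<Union>T\<in>{T. row_step n (Suc k) S T}. ?B T). ?f (?g a) = a"
      by (auto simp: partial_AST_def fun_eq_iff)
    show "?f ` ?A \<subseteq> (\<Union>T\<in>{T. row_step n (Suc k) S T}. ?B T)"
      using partial_AST_restrict(1,2) row_step_one_cols by auto
    show "?g ` (\<Union>T\<in>{T. row_step n (Suc k) S T}. ?B T) \<subseteq> ?A"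
      using partial_AST_extend[OF _ _ Suc.prems] by auto
  qed
  have finU: "finite (\<Union>T\<in>{T. row_step n (Suc k) S T}. ?B T)"
    using fin B by blast
  have "card ?A = card (\<Union>T\<in>{T. row_step n (Suc k) S T}. ?B T)"
    by (rule bij_betw_same_card[OF bij])
  also have "\<dots> = (\<Sum>T\<in>{T. row_step n (Suc k) S T}. card (?B T))"
    by (rule card_UN_disjoint) (use fin B in auto)
  also have "\<dots> = nchains n (Suc k) S"
    using B by simp
  finally show ?case
    using bij_betw_finite[OF bij] finU by blast
qed

text \<open>The \<open>f_p\<close> of the overview for column \<open>s\<close> after
  \<open>k\<close> rows. A column on the left dropped out \<open>k - s\<close> rows ago, one on the
  right \<open>k + s - 2 * n\<close> rows ago; for the latter, \<open>w powi (s - n)\<close> and the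
  denominators of \<open>(w - 1) / w\<close> combine to the exponent \<open>n - k\<close>.\<close>

definition one_weight :: "nat \<Rightarrow> nat \<Rightarrow> nat \<Rightarrow> laurent" where
  "one_weight n k s = (if s < k then (1 - shift 1) ^ (k - s) * shift (int s - int n)
     else if s \<le> 2 * n - k then shift (int s - int n)
     else (shift 1 - 1) ^ (k + s - 2 * n) * shift (int n - int k))"

lemma one_weight_left:
  assumes "s < Suc k" "Suc k \<le> n"
  shows "one_weight n (Suc k) s = (1 - shift 1) * one_weight n k s"
  using assms by (cases "s = k") (auto simp: one_weight_def Suc_diff_le)

lemma one_weight_right:
  assumes "s > 2 * n - Suc k" "Suc k \<le> n"
  shows "one_weight n (Suc k) s * shift 1 = (shift 1 - 1) * one_weight n k s"
proof (cases "s = 2 * n - k")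
  \<comment> \<open>Column \<open>2 * n - k\<close> is active in row \<open>k\<close> and inactive
    in row \<open>Suc k\<close>, so only the new weight contains \<open>shift 1 - 1\<close>, to the
    first power.\<close>
  case True
  then have "Suc k + s - 2 * n = 1" "int s - int n = int n - int k" "\<not> s < Suc k" "\<not> s < k" using assms by auto
  then show ?thesis
    using True assms by (simp add: one_weight_def mult.assoc flip: shift_add)
next
  case False
  then have "Suc k + s - 2 * n = Suc (k + s - 2 * n)" "s > 2 * n - k" "\<not> s < Suc k" using assms by auto
  then show ?thesis
    using assms by (simp add: one_weight_def mult.assoc flip: shift_add)
qed

lemma one_weight_mid:
  assumes "s \<in> row_cols n k"
  shows "one_weight n k s = shift (int s - int n)"
  using assms by (auto simp: one_weight_def row_cols_def)

section \<open>Interlacing of sorted lists and counting functions\<close>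

lemma card_less_sorted:
  fixes xs :: "nat list"
  assumes "sorted_wrt (<) xs" "i < length xs"
  shows "xs ! i < c \<longleftrightarrow> i < card (set xs \<inter> {..<c})"
proof -
  define m where "m = card {j. j < length xs \<and> xs ! j < c}"
  have inj: "inj_on ((!) xs) {j. j < length xs \<and> xs ! j < c}"
    using assms(1) by (auto simp: inj_on_def strict_sorted_iff nth_eq_iff_index_eq)
  have "set xs \<inter> {..<c} = (!) xs ` {j. j < length xs \<and> xs ! j < c}"
    by (auto simp: in_set_conv_nth)
  then have m: "card (set xs \<inter> {..<c}) = m"
    unfolding m_def using card_image[OF inj] by simp
  have mono: "xs ! j \<le> xs ! i" if "j \<le> i" "i < length xs" for i j
    using that sorted_wrt_nth_less[OF assms(1), of j i] by (cases "j = i") auto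
  show ?thesis
  proof
    assume "xs ! i < c"
    then have "{..i} \<subseteq> {j. j < length xs \<and> xs ! j < c}"
      using mono assms(2) by (auto intro: le_less_trans)
    then have "card {..i} \<le> m" unfolding m_def by (intro card_mono) auto
    then show "i < card (set xs \<inter> {..<c})" unfolding m by simp
  next
    assume i: "i < card (set xs \<inter> {..<c})"
    show "xs ! i < c"
    proof (rule ccontr)
      assume "\<not> xs ! i < c"
      then have "{j. j < length xs \<and> xs ! j < c} \<subseteq> {..<i}"
        using mono[of i] by (auto simp: not_less) (meson le_trans not_le)
      then have "m \<le> card {..<i}" unfolding m_def by (intro card_mono) auto
      then show False using i m by simp
    qed
  qed
qed

text \<open>By \<open>card_less_sorted\<close> the counts below \<open>c\<close> and the sorted
  entries determine each other. The weak inequalities come from the bounds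
  \<open>Suc (ys ! i)\<close> and \<open>Suc (xs ! Suc i)\<close>.\<close>

lemma interlacing_iff:
  fixes xs ys :: "nat list"
  assumes xs: "sorted_wrt (<) xs" and ys: "sorted_wrt (<) ys" and len: "length xs = Suc (length ys)"
  shows "(\<forall>c. int (card (set xs \<inter> {..<c})) - int (card (set ys \<inter> {..<c})) \<in> {0, 1}) \<longleftrightarrow>
    (\<forall>i<length ys. xs ! i \<le> ys ! i \<and> ys ! i \<le> xs ! Suc i)" (is "?A \<longleftrightarrow> ?B")
proof
  assume A: ?A
  have a: "card (set xs \<inter> {..<c}) \<in> {card (set ys \<inter> {..<c}), Suc (card (set ys \<inter> {..<c}))}" for c
    using A[rule_format, of c] by auto
  show ?B
  proof (intro allI impI conjI)
    fix i assume i: "i < length ys"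
    have "i < card (set ys \<inter> {..<Suc (ys ! i)})"
      using card_less_sorted[OF ys i, of "Suc (ys ! i)"] by simp
    then have "i < card (set xs \<inter> {..<Suc (ys ! i)})" using a[of "Suc (ys ! i)"] by auto
    then show "xs ! i \<le> ys ! i"
      using card_less_sorted[OF xs, of i "Suc (ys ! i)"] i len by simp
    have "Suc i < card (set xs \<inter> {..<Suc (xs ! Suc i)})"
      using card_less_sorted[OF xs, of "Suc i" "Suc (xs ! Suc i)"] i len by simp
    then have "i < card (set ys \<inter> {..<Suc (xs ! Suc i)})" using a[of "Suc (xs ! Suc i)"] by auto
    then show "ys ! i \<le> xs ! Suc i"
      using card_less_sorted[OF ys i, of "Suc (xs ! Suc i)"] by simp
  qed
next
  assume B: ?B
  show ?A
  proof
    fix c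
    let ?m = "card (set xs \<inter> {..<c})" and ?y = "card (set ys \<inter> {..<c})"
    have my: "?m \<le> length xs" "?y \<le> length ys"
      by (meson Int_lower1 List.finite_set card_length card_mono le_trans)+
    have "?y \<le> ?m"
    proof (rule ccontr)
      assume "\<not> ?y \<le> ?m"
      then have i: "?m < length ys" "?m < ?y" using my by auto
      then have "ys ! ?m < c" using card_less_sorted[OF ys i(1), of c] by simp
      then have "xs ! ?m < c" using B i by (meson le_less_trans)
      then show False using card_less_sorted[OF xs, of ?m c] i len by simp
    qed
    moreover have "?m \<le> Suc ?y"
    proof (rule ccontr)
      assume "\<not> ?m \<le> Suc ?y"
      then have i: "?y < length ys" "Suc ?y < ?m" "Suc ?y < length xs" using my len by auto
      then have "xs ! Suc ?y < c" using card_less_sorted[OF xs i(3), of c] by simp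
      then have "ys ! ?y < c" using B i by (meson le_less_trans)
      then show False using card_less_sorted[OF ys i(1), of c] by simp
    qed
    ultimately show "int ?m - int ?y \<in> {0, 1}" by auto
  qed
qed

lemma sorted_list_of_set_append3:
  fixes L R :: "nat set"
  assumes "finite L" "finite R" "sorted_wrt (<) ys"
    and "\<And>x y. x \<in> L \<Longrightarrow> y \<in> set ys \<union> R \<Longrightarrow> x < y" "\<And>x y. x \<in> set ys \<Longrightarrow> y \<in> R \<Longrightarrow> x < y"
  shows "sorted_list_of_set (L \<union> set ys \<union> R) = sorted_list_of_set L @ ys @ sorted_list_of_set R"
proof -
  have "sorted_wrt (<) (sorted_list_of_set L @ ys @ sorted_list_of_set R)"
    using assms by (auto simp: sorted_wrt_append)
  then have "sorted (sorted_list_of_set L @ ys @ sorted_list_of_set R)" "distinct (sorted_list_of_set L @ ys @ sorted_list_of_set R)"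
    by (auto simp: strict_sorted_iff)
  then show ?thesis
    using sorted_list_of_set.idem_if_sorted_distinct[of "sorted_list_of_set L @ ys @ sorted_list_of_set R"] assms(1,2)
    by (simp add: Un_assoc)
qed

lemma bethe_cong: "(\<And>p. p < k \<Longrightarrow> f p = g p) \<Longrightarrow> bethe k f = bethe k g"
  unfolding bethe_def by (intro arg_cong[of _ _ "Lam k"] arg_cong2[of _ _ _ _ "(*)"] prod.cong) auto

lemma bethe_0: "bethe 0 f = 1"
  by (simp add: bethe_def nprod_def Lam_def linext_one)

section \<open>Chains as a determinantal functional\<close>

text \<open>Every element of \<open>S\<close> is then frozen, so \<open>S\<close> is contained in
  \<open>T\<close> and cannot have one element more.\<close>

lemma row_step_empty_block:
  assumes "row_step n i S T" "finite S" "S \<inter> row_cols n i = {}"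
  shows False
proof -
  have "S \<subseteq> T" using assms(1,3) unfolding row_step_def by blast
  moreover have "finite T" using assms(1) by (simp add: row_step_def)
  ultimately have "card S \<le> card T" by (intro card_mono)
  then show False using assms(1) unfolding row_step_def by simp
qed

lemma ev1_one_weight_outside:
  assumes "s \<notin> row_cols n k"
  shows "ev1 (one_weight n k s) = 0"
proof -
  have pow: "ev1 (f ^ m) = ev1 f ^ m" for f m by (induction m) (simp_all add: ev1_mult)
  show ?thesis
    using assms by (auto simp: one_weight_def ev1_mult pow ev1_diff row_cols_def)
qed

text \<open>Columns outside row \<open>i\<close> are common to both sets and cancel from all counts,
  so only the active parts have to interlace; sorting them gives the lists in
  \<open>ilace\<close>.\<close>

lemma sum_row_step:
  fixes S :: "nat set"
  assumes S: "finite S" and M: "S \<inter> row_cols n i \<noteq> {}"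
  defines "L \<equiv> {s \<in> S. s < i}" and "R \<equiv> {s \<in> S. s > 2 * n - i}"
  defines "xs \<equiv> sorted_list_of_set (S \<inter> row_cols n i)"
  shows "(\<Sum>T\<in>{T. row_step n i S T}. F T) = (\<Sum>ys\<in>ilace (length xs - 1) ((!) xs). F (L \<union> set ys \<union> R))"
proof (rule sum.reindex_bij_witness[of _ "\<lambda>ys. L \<union> set ys \<union> R" "\<lambda>T. sorted_list_of_set (T \<inter> row_cols n i)"])
  have fin: "finite (row_cols n i)" by (simp add: row_cols_def)
  have xs: "sorted_wrt (<) xs" "set xs = S \<inter> row_cols n i" "xs \<noteq> []" "length xs = card (S \<inter> row_cols n i)"
    unfolding xs_def using M fin by auto
  have out: "S - row_cols n i = L \<union> R" "(L \<union> R) \<inter> row_cols n i = {}" "L \<inter> R = {}"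
    unfolding L_def R_def row_cols_def using S M by (auto simp: row_cols_def)
  have dec: "card (S \<inter> A) = card (set xs \<inter> A) + card ((L \<union> R) \<inter> A)" for A
  proof -
    have "S \<inter> A = (set xs \<inter> A) \<union> ((L \<union> R) \<inter> A)" "(set xs \<inter> A) \<inter> ((L \<union> R) \<inter> A) = {}"
      unfolding xs(2) using out by blast+
    then show ?thesis using S by (simp add: card_Un_disjoint L_def R_def)
  qed
  have key: "row_step n i S (Y \<union> (L \<union> R)) \<longleftrightarrow>
      (\<forall>c. int (card (set xs \<inter> {..<c})) - int (card (Y \<inter> {..<c})) \<in> {0, 1}) \<and> card (set xs) = Suc (card Y)"
    if Y: "Y \<subseteq> row_cols n i" for Y
  proof -
    have finY: "finite Y" using Y fin finite_subset by blast
    have decY: "card ((Y \<union> (L \<union> R)) \<inter> A) = card (Y \<inter> A) + card ((L \<union> R) \<inter> A)" for A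
    proof -
      have "(Y \<union> (L \<union> R)) \<inter> A = (Y \<inter> A) \<union> ((L \<union> R) \<inter> A)" "(Y \<inter> A) \<inter> ((L \<union> R) \<inter> A) = {}"
        using out Y by blast+
      then show ?thesis using S finY by (simp add: card_Un_disjoint L_def R_def)
    qed
    have agree: "\<forall>c. c \<notin> row_cols n i \<longrightarrow> (c \<in> S \<longleftrightarrow> c \<in> Y \<union> (L \<union> R))"
      using out Y by blast
    have finT: "finite (Y \<union> (L \<union> R))" using finY S by (simp add: L_def R_def)
    have diff: "int (card (S \<inter> A)) - int (card ((Y \<union> (L \<union> R)) \<inter> A)) = int (card (set xs \<inter> A)) - int (card (Y \<inter> A))" for A
      unfolding dec[of A] decY[of A] by simp
    show ?thesis
      unfolding row_step_def diff using agree finT dec[of UNIV] decY[of UNIV] by auto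
  qed
  {
    fix T assume "T \<in> {T. row_step n i S T}"
    then have T: "row_step n i S T" by simp
    let ?Y = "T \<inter> row_cols n i"
    have TY: "T = ?Y \<union> (L \<union> R)" using T out unfolding row_step_def by blast
    show 1: "L \<union> set (sorted_list_of_set ?Y) \<union> R = T"
      using TY fin by auto
    show "F (L \<union> set (sorted_list_of_set ?Y) \<union> R) = F T" unfolding 1 ..
    have "row_step n i S (?Y \<union> (L \<union> R))" using T TY by simp
    then have Y: "\<forall>c. int (card (set xs \<inter> {..<c})) - int (card (?Y \<inter> {..<c})) \<in> {0, 1}" "card (set xs) = Suc (card ?Y)"
      using key[of ?Y] by auto
    have len: "length xs = Suc (length (sorted_list_of_set ?Y))"
      using Y(2) xs fin by simp
    then show "sorted_list_of_set ?Y \<in> ilace (length xs - 1) ((!) xs)"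
      using interlacing_iff[OF xs(1), of "sorted_list_of_set ?Y"] Y(1) fin
      by (simp add: ilace_def)
  }
  {
    fix ys assume ys: "ys \<in> ilace (length xs - 1) ((!) xs)"
    then have y: "sorted_wrt (<) ys" "length xs = Suc (length ys)"
        "\<forall>i<length ys. xs ! i \<le> ys ! i \<and> ys ! i \<le> xs ! Suc i"
      using xs(3) by (auto simp: ilace_def Suc_diff_1)
    have sub: "set ys \<subseteq> row_cols n i"
    proof
      fix y assume "y \<in> set ys"
      then obtain m where m: "m < length ys" "y = ys ! m" by (auto simp: in_set_conv_nth)
      have "xs ! m \<in> row_cols n i" "xs ! Suc m \<in> row_cols n i"
        using m y(2) xs(2) nth_mem[of m xs] nth_mem[of "Suc m" xs] by auto
      then show "y \<in> row_cols n i" using y(3) m by (force simp: row_cols_def)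
    qed
    have "(L \<union> set ys \<union> R) \<inter> row_cols n i = set ys" using out(2) sub by blast
    then show "sorted_list_of_set ((L \<union> set ys \<union> R) \<inter> row_cols n i) = ys"
      using y(1) by (simp add: strict_sorted_iff sorted_list_of_set.idem_if_sorted_distinct)
    have "card (set xs) = Suc (card (set ys))"
      using xs(1) y(1,2) by (simp add: strict_sorted_iff distinct_card)
    moreover have "\<forall>c. int (card (set xs \<inter> {..<c})) - int (card (set ys \<inter> {..<c})) \<in> {0, 1}"
      using interlacing_iff[OF xs(1) y(1,2)] y(3) by blast
    ultimately have "row_step n i S (set ys \<union> (L \<union> R))" using key[OF sub] by blast
    then show "L \<union> set ys \<union> R \<in> {T. row_step n i S T}" by (simp add: Un_ac)
  }
qed

theorem nchains_eq_bethe: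
  assumes "k \<le> n" "S \<subseteq> {1..2 * n - 1}" "card S = k"
  shows "of_nat (nchains n k S) = bethe k (\<lambda>p. one_weight n k (sorted_list_of_set S ! p))"
  using assms
proof (induction k arbitrary: S)
  case 0
  then have "S = {}" using finite_subset[OF 0(2)] by simp
  then show ?case by (simp add: bethe_0)
next
  case (Suc k)
  let ?I = "row_cols n (Suc k)"
  have finS: "finite S" using Suc.prems(2) finite_subset by blast
  let ?f = "\<lambda>p. one_weight n (Suc k) (sorted_list_of_set S ! p)"
  show ?case
  proof (cases "S \<inter> ?I = {}")
    \<comment> \<open>Without active columns both sides vanish: no previous set exists, and every
      weight is zero at \<open>w = 1\<close>.\<close>
    case True
    then have "{T. row_step n (Suc k) S T} = {}"
      using row_step_empty_block[OF _ finS] by blast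
    moreover have "bethe (Suc k) ?f = 0"
    proof (rule bethe_Suc_zero)
      fix i assume "i \<le> k"
      then have "sorted_list_of_set S ! i \<in> S"
        using Suc.prems(3) finS nth_mem[of i "sorted_list_of_set S"] by simp
      then show "ev1 (?f i) = 0" using True by (intro ev1_one_weight_outside) blast
    qed
    ultimately show ?thesis by (simp only: nchains.simps sum.empty of_nat_0)
  next
    case False
    define L where "L = {s \<in> S. s < Suc k}"
    define R where "R = {s \<in> S. s > 2 * n - Suc k}"
    define xs where "xs = sorted_list_of_set (S \<inter> ?I)"
    define a where "a = card L"
    define r where "r = length xs - 1"
    define ls where "ls = sorted_list_of_set L"
    define rs where "rs = sorted_list_of_set R"
    have finI: "finite (S \<inter> ?I)" using finS by simp
    have xs: "sorted_wrt (<) xs" "set xs = S \<inter> ?I" "xs \<noteq> []"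
      unfolding xs_def using False finI by auto
    have lxs: "length xs = Suc r" using xs(3) by (simp add: r_def)
    have finLR: "finite L" "finite R" using finS by (auto simp: L_def R_def)
    have lens: "length ls = a" "length rs = card R" by (simp_all add: ls_def rs_def a_def)
    have sl: "sorted_list_of_set (L \<union> set ys \<union> R) = ls @ ys @ rs"
      if "sorted_wrt (<) ys" "set ys \<subseteq> ?I" for ys
      unfolding ls_def rs_def
      by (rule sorted_list_of_set_append3[OF finLR that(1)])
         (use that(2) Suc.prems(1) in \<open>auto simp: L_def R_def row_cols_def\<close>)
    have "S = L \<union> set xs \<union> R"
      unfolding xs(2) L_def R_def row_cols_def using Suc.prems(1) by auto
    then have slS: "sorted_list_of_set S = ls @ xs @ rs"
      using sl[of xs] xs by simp
    have k: "k = a + r + card R"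
      using arg_cong[OF slS, of length] Suc.prems(3) finS lens lxs by simp
    \<comment> \<open>Weights after \<open>k\<close> rows of the inactive columns. The active block
      has lost one column, hence the index \<open>p - a - r\<close>. For \<open>a \<le> p\<close>
      and \<open>p < a + r\<close> the value is a dummy, overridden in
      \<open>bethe_step\<close>.\<close>
    define f' where "f' p = one_weight n k (if p < a then ls ! p else rs ! (p - a - r))" for p
    have ls: "ls ! p \<in> L" if "p < a" for p
      using that lens finLR nth_mem[of p ls] by (simp add: ls_def)
    have rs: "rs ! p \<in> R" if "p < card R" for p
      using that lens finLR nth_mem[of p rs] by (simp add: rs_def)
    have "bethe (Suc k) ?f = (\<Sum>ys\<in>ilace r ((!) xs).
        bethe k (\<lambda>p. if a \<le> p \<and> p < a + r then shift (int (ys ! (p - a)) - int n) else f' p))"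
    proof (rule bethe_step)
      show "a + r \<le> k" using k by simp
      show "xs ! i < xs ! Suc i" if "i < r" for i
        using that xs(1) lxs by (simp add: sorted_wrt_nth_less)
      show "?f p = (1 - shift 1) * f' p" if "p < a" for p
        using that ls[OF that] Suc.prems(1) lens
        by (simp add: slS nth_append f'_def one_weight_left L_def)
      show "?f (a + i) = shift (int (xs ! i) - int n)" if "i \<le> r" for i
      proof -
        have "xs ! i \<in> ?I" using that lxs nth_mem[of i xs] xs(2) by auto
        then show ?thesis using that lens lxs by (simp add: slS nth_append one_weight_mid)
      qed
      show "?f (Suc p) * shift 1 = (shift 1 - 1) * f' p" if p: "a + r \<le> p" "p < k" for p
      proof -
        have "rs ! (p - a - r) \<in> R" using p k by (intro rs) simp
        then have "rs ! (p - a - r) > 2 * n - Suc k" by (simp add: R_def)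
        moreover have "sorted_list_of_set S ! Suc p = rs ! (p - a - r)"
        proof -
          have "Suc p - a - Suc r = p - a - r" "\<not> Suc p - a < Suc r" using p by auto
          then show ?thesis using p lens lxs by (simp add: slS nth_append)
        qed
        ultimately show ?thesis
          using Suc.prems(1) p by (simp add: f'_def one_weight_right)
      qed
    qed
    also have "\<dots> = (\<Sum>ys\<in>ilace r ((!) xs). of_nat (nchains n k (L \<union> set ys \<union> R)))"
    proof (intro sum.cong refl)
      fix ys assume ys: "ys \<in> ilace r ((!) xs)"
      then have y: "sorted_wrt (<) ys" "length ys = r" "\<forall>i<r. xs ! i \<le> ys ! i \<and> ys ! i \<le> xs ! Suc i"
        by (auto simp: ilace_def)
      have sub: "set ys \<subseteq> ?I"
      proof
        fix y assume "y \<in> set ys"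
        then obtain m where m: "m < r" "y = ys ! m" using y(2) by (auto simp: in_set_conv_nth)
        have "xs ! m \<in> ?I" "xs ! Suc m \<in> ?I"
          using m xs(2) nth_mem[of m xs] nth_mem[of "Suc m" xs] lxs by auto
        then show "y \<in> ?I" using y(3) m by (force simp: row_cols_def)
      qed
      let ?T = "L \<union> set ys \<union> R"
      note slT = sl[OF y(1) sub]
      have "?T \<subseteq> {1..2 * n - 1}"
      proof -
        have "?I \<subseteq> {1..2 * n - 1}" by (auto simp: row_cols_def)
        then show ?thesis using sub Suc.prems(2) by (auto simp: L_def R_def)
      qed
      moreover have "card ?T = k"
        using arg_cong[OF slT, of length] k lens y(2) by simp
      ultimately have "of_nat (nchains n k ?T) = bethe k (\<lambda>p. one_weight n k (sorted_list_of_set ?T ! p))"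
        using Suc.IH Suc.prems(1) by simp
      also have "\<dots> = bethe k (\<lambda>p. if a \<le> p \<and> p < a + r then shift (int (ys ! (p - a)) - int n) else f' p)"
      proof (rule bethe_cong)
        fix p assume p: "p < k"
        consider "p < a" | "a \<le> p" "p < a + r" | "a + r \<le> p" by linarith
        then show "one_weight n k (sorted_list_of_set ?T ! p) =
            (if a \<le> p \<and> p < a + r then shift (int (ys ! (p - a)) - int n) else f' p)"
        proof cases
          case 1
          then show ?thesis using lens by (simp add: slT nth_append f'_def)
        next
          case 2
          then have "ys ! (p - a) \<in> ?I" using sub y(2) nth_mem[of "p - a" ys] by auto
          then have "ys ! (p - a) \<in> row_cols n k" by (auto simp: row_cols_def)
          moreover have "p - a < r" using 2 by simp
          ultimately show ?thesis using 2 lens y(2) by (simp add: slT nth_append one_weight_mid)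
        next
          case 3
          then have "\<not> p - a < r" by simp
          with 3 show ?thesis using lens y(2) by (simp add: slT nth_append f'_def)
        qed
      qed
      finally show "bethe k (\<lambda>p. if a \<le> p \<and> p < a + r then shift (int (ys ! (p - a)) - int n) else f' p) =
          of_nat (nchains n k ?T)" ..
    qed
    also have "\<dots> = of_nat (nchains n (Suc k) S)"
      using sum_row_step[OF finS False, of "\<lambda>T. of_nat (nchains n k T) :: rat"]
      by (simp add: L_def R_def xs_def r_def)
    finally show ?thesis ..
  qed
qed

text \<open>The last row has \<open>n\<close> as its only position, so the entry there is 1; as a
  difference of indicators it can be 1 only if \<open>n\<close> is a 1-column at the end.\<close>

lemma one_cols_center:
  assumes "partial_AST n n a" "n \<ge> 1"
  shows "n \<in> one_cols n a"
proof -
  obtain m where m: "n = Suc m" using assms(2) by (cases n) auto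
  have "row_cols n n = {n}" by (auto simp: row_cols_def)
  then have "a n c = 0" if "c \<noteq> n" for c using assms(1) that unfolding partial_AST_def by auto
  then have "sum (a n) {..2 * n} = a n n"
    by (subst sum.remove[of _ n]) auto
  then have "a n n = 1" using assms unfolding partial_AST_def by auto
  then have "a (Suc m) n = 1" by (simp add: m)
  then show ?thesis
    using partial_AST_restrict(3)[of n m a n] assms(1) unfolding m
    by (auto simp: of_bool_def split: if_splits)
qed

lemma row_step_center:
  assumes "C \<subseteq> {1..2 * n - 1} - {n}"
  shows "{T. row_step n n (insert n C) T} = {C}"
proof -
  have rc: "row_cols n n = {n}" by (auto simp: row_cols_def)
  have fin: "finite C" using assms finite_subset by blast
  have "T = C" if T: "row_step n n (insert n C) T" for T
  proof -
    have "T - {n} = C" using T assms unfolding row_step_def rc by blast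
    moreover have "n \<notin> T"
    proof
      assume "n \<in> T"
      then have "T = insert n C" using \<open>T - {n} = C\<close> by blast
      then show False using T by (simp add: row_step_def)
    qed
    ultimately show ?thesis by blast
  qed
  moreover have "row_step n n (insert n C) C"
  proof -
    have "int (card (insert n C \<inter> {..<c})) - int (card (C \<inter> {..<c})) \<in> {0, 1}" for c
    proof (cases "n < c")
      case True
      then have "insert n C \<inter> {..<c} = insert n (C \<inter> {..<c})" by auto
      moreover have "n \<notin> C" using assms by blast
      ultimately show ?thesis using fin by simp
    next
      case False
      then have "insert n C \<inter> {..<c} = C \<inter> {..<c}" by auto
      then show ?thesis by simp
    qed
    moreover have "card (insert n C) = Suc (card C)"
      using assms fin by (intro card_insert_disjoint) auto
    ultimately show ?thesis using fin unfolding row_step_def rc by auto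
  qed
  ultimately show ?thesis by blast
qed

lemma num_AST_eq_nchains:
  assumes n: "n \<ge> 1" and C: "C \<subseteq> {1..2 * n - 1} - {n}" and j: "col_position n ` C = j ` {1..n - 1}"
  shows "num_AST n j = nchains n (n - 1) C"
proof -
  have inj: "inj_on (col_position n) ({1..2 * n - 1} - {n})"
    by (auto simp: inj_on_def col_position_def split: if_splits)
  have "is_AST n a \<and> one_col_positions n a = j ` {1..n - 1} \<longleftrightarrow>
      partial_AST n n a \<and> one_cols n a = insert n C" for a
  proof (cases "partial_AST n n a")
    case True
    have "(\<Sum>i\<in>col_rows n c. a i c) = (\<Sum>i=1..n. a i c)" for c
      by (rule sum.mono_neutral_left) (use True in \<open>auto simp: partial_AST_def col_rows_def\<close>)
    then have "{c \<in> {1..2 * n - 1} - {n}. is_one_col n a c} = one_cols n a - {n}"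
      using one_cols_subset[OF True] by (auto simp: is_one_col_def one_cols_def)
    then have "one_col_positions n a = col_position n ` (one_cols n a - {n})"
      unfolding one_col_positions_def by (rule arg_cong)
    then have "one_col_positions n a = j ` {1..n - 1} \<longleftrightarrow> one_cols n a - {n} = C"
      unfolding j[symmetric] using inj_on_image_eq_iff[OF inj, of "one_cols n a - {n}" C] one_cols_subset[OF True] C
      by auto
    also have "\<dots> \<longleftrightarrow> one_cols n a = insert n C"
      using one_cols_center[OF True n] C by blast
    finally show ?thesis using True is_AST_iff_partial_AST[OF n] by blast
  qed (use is_AST_iff_partial_AST[OF n] in blast)
  then have "num_AST n j = card {a. partial_AST n n a \<and> one_cols n a = insert n C}"
    by (simp add: num_AST_def)
  also have "\<dots> = nchains n n (insert n C)"
  proof -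
    have "n \<in> {1..2 * n - 1}" using n by simp
    then have "insert n C \<subseteq> {1..2 * n - 1}" using C by blast
    then show ?thesis using card_partial_AST by blast
  qed
  also have "\<dots> = nchains n (n - 1) C"
  proof -
    obtain m where m: "n = Suc m" using n by (cases n) auto
    have "nchains n (Suc m) (insert n C) = nchains n m C"
      using row_step_center[OF C] by (simp add: m)
    then show ?thesis by (simp add: m)
  qed
  finally show ?thesis .
qed

section \<open>Moving the left variables\<close>

text \<open>\<open>nf c q = 1 + w_c (w_q - 1)\<close> fits \<open>Lam_coinv\<close> with
  \<open>b = w_c\<close>, so each full product over \<open>q\<close> acts as 1.\<close>

lemma Lam_prod_nf:
  assumes "c \<le> m"
  shows "Lam m (H * (\<Prod>l<c. \<Prod>q<m. nf l q)) = Lam m H"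
  using assms
proof (induction c arbitrary: H)
  case (Suc c)
  have nf: "nf c q = 1 + emb c (shift 1) * emb q (shift 1 - 1)" for q
    by (simp add: nf_def emb_diff algebra_simps)
  have "Lam m (H * (\<Prod>l<Suc c. \<Prod>q<m. nf l q)) = Lam m (H * (\<Prod>q<m. nf c q) * (\<Prod>l<c. \<Prod>q<m. nf l q))"
    by (simp add: mult_ac)
  also have "\<dots> = Lam m (H * (\<Prod>q<m. nf c q))" using Suc by simp
  also have "\<dots> = Lam m H" unfolding nf by (rule Lam_coinv)
  finally show ?case .
qed simp

lemma emb_inverse [simp]: "emb l (shift 1) * emb l (shift (-1)) = 1" "emb l (shift (-1)) * emb l (shift 1) = 1"
  by (simp_all flip: emb_mult shift_add)

text \<open>Here \<open>nf q c = w_c (1 + (1 - 1 / w_c) (w_q - 1))\<close>, so each full product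
  over \<open>q\<close> acts as \<open>w_c ^ m\<close>.\<close>

lemma Lam_prod_nf_rev:
  assumes "c \<le> m"
  shows "Lam m (H * (\<Prod>l<c. \<Prod>q<m. nf q l)) = Lam m (H * (\<Prod>l<c. emb l (shift 1) ^ m))"
  using assms
proof (induction c arbitrary: H)
  case (Suc c)
  have nf: "nf q c = emb c (shift 1) * (1 + (1 - emb c (shift (-1))) * emb q (shift 1 - 1))" for q
  proof -
    have "emb c (shift 1) * (1 + (1 - emb c (shift (-1))) * emb q (shift 1 - 1)) =
        emb c (shift 1) + (emb c (shift 1) - emb c (shift 1) * emb c (shift (-1))) * emb q (shift 1 - 1)"
      by (simp add: algebra_simps del: emb_inverse)
    then show ?thesis by (simp add: nf_def emb_diff algebra_simps)
  qed
  have "Lam m (H * (\<Prod>l<Suc c. \<Prod>q<m. nf q l)) = Lam m (H * (\<Prod>q<m. nf q c) * (\<Prod>l<c. \<Prod>q<m. nf q l))"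
    by (simp add: mult_ac)
  also have "\<dots> = Lam m (H * (\<Prod>q<m. nf q c) * (\<Prod>l<c. emb l (shift 1) ^ m))" using Suc by simp
  also have "\<dots> = Lam m (H * (\<Prod>l<Suc c. emb l (shift 1) ^ m) *
      (\<Prod>q<m. 1 + (1 - emb c (shift (-1))) * emb q (shift 1 - 1)))"
    unfolding nf prod.distrib by (simp add: mult_ac)
  also have "\<dots> = Lam m (H * (\<Prod>l<Suc c. emb l (shift 1) ^ m))" by (rule Lam_coinv)
  finally show ?case .
qed simp

text \<open>The full products in the two orders share the factor \<open>?Q\<close> from pairs of
  left variables. Inserting the one that acts as 1 and then replacing the reversed one by the powers
  \<open>w_l ^ m\<close> exchanges \<open>?P2\<close> for \<open>?P1\<close>.\<close>

lemma Lam_rotate: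
  assumes "c \<le> m"
  shows "Lam m (H * (\<Prod>l<c. \<Prod>q\<in>{c..<m}. nf q l)) =
    Lam m (H * (\<Prod>l<c. emb l (shift 1) ^ m) * (\<Prod>l<c. \<Prod>q\<in>{c..<m}. nf l q))"
proof -
  let ?P1 = "\<Prod>l<c. \<Prod>q\<in>{c..<m}. nf l q" and ?P2 = "\<Prod>l<c. \<Prod>q\<in>{c..<m}. nf q l"
  let ?Q = "\<Prod>l<c. \<Prod>s<c. nf l s"
  have split: "prod F {..<m} = prod F {..<c} * prod F {c..<m}" for F :: "nat \<Rightarrow> mlaurent"
    using assms by (simp add: prod.atLeastLessThan_concat lessThan_atLeast0)
  have 1: "(\<Prod>l<c. \<Prod>q<m. nf l q) = ?Q * ?P1"
    by (simp only: split prod.distrib)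
  have 2: "(\<Prod>l<c. \<Prod>q<m. nf q l) = ?Q * ?P2"
    by (simp only: split prod.distrib prod.swap[of "\<lambda>l s. nf s l" "{..<c}" "{..<c}"])
  have "Lam m (H * ?P2) = Lam m (H * ?P2 * (\<Prod>l<c. \<Prod>q<m. nf l q))"
    by (rule Lam_prod_nf[OF assms, symmetric])
  also have "H * ?P2 * (\<Prod>l<c. \<Prod>q<m. nf l q) = H * ?P1 * (\<Prod>l<c. \<Prod>q<m. nf q l)"
    unfolding 1 2 by (simp only: mult_ac)
  also have "Lam m \<dots> = Lam m (H * ?P1 * (\<Prod>l<c. emb l (shift 1) ^ m))"
    by (rule Lam_prod_nf_rev[OF assms])
  finally show ?thesis by (simp only: mult_ac)
qed

section \<open>Products over pairs and the Vandermonde determinant\<close>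

abbreviation pairs :: "nat \<Rightarrow> (nat \<times> nat) set" where
  "pairs m \<equiv> {(p, q). p < q \<and> q < m}"

lemma pairs_Suc: "pairs (Suc m) = pairs m \<union> (\<lambda>p. (p, m)) ` {..<m}"
  by auto

lemma prod_pairs_Suc:
  "(\<Prod>(p, q)\<in>pairs (Suc m). f p q) = (\<Prod>(p, q)\<in>pairs m. f p q) * (\<Prod>p<m. f p m)"
  unfolding pairs_Suc
  by (subst prod.union_disjoint) (auto simp: finite_pairs prod.reindex inj_on_def)

text \<open>Every index lies in \<open>m - 1\<close> of the pairs.\<close>

lemma prod_pairs_mult:
  fixes f :: "nat \<Rightarrow> 'a::comm_monoid_mult"
  shows "(\<Prod>(p, q)\<in>pairs m. f p * f q) = (\<Prod>p<m. f p ^ (m - 1))"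
proof (induction m)
  case (Suc m)
  have "(\<Prod>p<m. f p ^ (m - 1)) * (\<Prod>p<m. f p) = (\<Prod>p<m. f p ^ m)"
    unfolding prod.distrib[symmetric]
    by (intro prod.cong refl) (metis gr_zeroI lessThan_iff not_less_zero power_minus_mult)
  then show ?case
    unfolding prod_pairs_Suc Suc by (simp add: prod.distrib mult.assoc[symmetric])
qed simp

text \<open>The matrix \<open>T\<close> subtracts \<open>v m\<close> times each column from the next
  one. The last row becomes 1 followed by zeros, and row \<open>i\<close> of the remaining minor has
  the factor \<open>v i - v m\<close>.\<close>

lemma det_vandermonde:
  fixes v :: "nat \<Rightarrow> 'a::comm_ring_1"
  shows "det (mat m m (\<lambda>(i, j). v i ^ j)) = (\<Prod>(p, q)\<in>pairs m. v q - v p)"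
proof (induction m)
  case 0
  then show ?case by simp
next
  case (Suc m)
  define M where "M = mat (Suc m) (Suc m) (\<lambda>(i, j). v i ^ j)"
  define T where "T = mat (Suc m) (Suc m) (\<lambda>(i, j). if i = j then 1 else if Suc i = j then - v m else 0)"
  define N where "N = mat (Suc m) (Suc m) (\<lambda>(i, j). case j of 0 \<Rightarrow> 1 | Suc j' \<Rightarrow> (v i - v m) * v i ^ j')"
  have T: "T \<in> carrier_mat (Suc m) (Suc m)" and M: "M \<in> carrier_mat (Suc m) (Suc m)"
    and N: "N \<in> carrier_mat (Suc m) (Suc m)" by (simp_all add: T_def M_def N_def)
  have "det T = prod_list (diag_mat T)"
    by (rule det_upper_triangular[OF _ T]) (auto simp: T_def upper_triangular_def)
  also have "diag_mat T = replicate (Suc m) 1"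
    by (rule replicate_eqI) (auto simp: diag_mat_def T_def simp del: upt_Suc)
  finally have "det T = 1" by simp
  moreover have "M * T = N"
  proof (rule eq_matI)
    fix i j assume ij: "i < dim_row N" "j < dim_col N"
    then have i: "i < Suc m" and j: "j < Suc m" by (simp_all add: N_def)
    have "(M * T) $$ (i, j) = (\<Sum>l<Suc m. v i ^ l * T $$ (l, j))"
      using i j by (simp add: T_def M_def scalar_prod_def atLeast0LessThan)
    also have "\<dots> = (\<Sum>l<Suc m. (if l = j then v i ^ l else 0) + (if Suc l = j then v i ^ l * - v m else 0))"
      using j by (intro sum.cong) (auto simp: T_def)
    also have "\<dots> = v i ^ j + (case j of 0 \<Rightarrow> 0 | Suc j' \<Rightarrow> v i ^ j' * - v m)"
      unfolding sum.distrib using j by (cases j) (simp_all add: sum.delta' if_distrib cong: if_cong del: sum.lessThan_Suc)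
    finally show "(M * T) $$ (i, j) = N $$ (i, j)"
      using i j by (simp add: N_def algebra_simps split: nat.splits)
  qed (simp_all add: M_def T_def N_def)
  ultimately have "det M = det N"
    using det_mult[OF M T] by simp
  also have "\<dots> = (\<Sum>j<Suc m. N $$ (m, j) * cofactor N m j)"
    by (rule laplace_expansion_row[OF N]) simp
  also have "\<dots> = (\<Sum>j<Suc m. if j = 0 then cofactor N m 0 else 0)"
    by (intro sum.cong refl) (auto simp: N_def split: nat.splits)
  also have "\<dots> = cofactor N m 0" by (simp del: sum.lessThan_Suc)
  also have "\<dots> = (-1) ^ m * det (mat m m (\<lambda>(i, j). (v i - v m) * v i ^ j))"
  proof -
    have "mat_delete N m 0 = mat m m (\<lambda>(i, j). (v i - v m) * v i ^ j)"
      by (intro eq_matI) (auto simp: mat_delete_def N_def)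
    then show ?thesis by (simp add: cofactor_def)
  qed
  also have "det (mat m m (\<lambda>(i, j). (v i - v m) * v i ^ j)) = (\<Prod>i<m. v i - v m) * det (mat m m (\<lambda>(i, j). v i ^ j))"
    unfolding det_mat_leibniz prod.distrib sum_distrib_left
    by (simp add: mult.left_commute lessThan_atLeast0)
  also have "(-1) ^ m * ((\<Prod>i<m. v i - v m) * det (mat m m (\<lambda>(i, j). v i ^ j))) =
      (\<Prod>i<m. v m - v i) * det (mat m m (\<lambda>(i, j). v i ^ j))"
  proof -
    have "(\<Prod>i<m. v m - v i) = (\<Prod>i<m. - 1 * (v i - v m))" by (intro prod.cong) auto
    then show ?thesis unfolding prod.distrib by (simp add: mult.assoc)
  qed
  finally show ?case
    unfolding M_def Suc prod_pairs_Suc by (simp only: mult.commute)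
qed

section \<open>Evaluation of polynomials and coefficients as constant terms\<close>

text \<open>Variables are numbered from \<open>1\<close> in the statement and from \<open>0\<close> here.\<close>

definition insertion :: "nat \<Rightarrow> (nat \<Rightarrow> 'b::comm_ring_1) \<Rightarrow> mpoly_int \<Rightarrow> 'b" where
  "insertion m g = linext (\<lambda>a. \<Prod>i<m. g i ^ Poly_Mapping.lookup a (Suc i))"

lemma insertion_mult: "insertion m g (P * Q) = insertion m g P * insertion m g Q"
  unfolding insertion_def by (rule linext_hom) (simp add: lookup_add power_add prod.distrib)

lemma insertion_one [simp]: "insertion m g 1 = 1"
  by (simp add: insertion_def linext_one)

lemma insertion_prod: "insertion m g (\<Prod>i\<in>I. P i) = (\<Prod>i\<in>I. insertion m g (P i))"
  by (induction I rule: infinite_finite_induct) (simp_all add: insertion_mult)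

lemma insertion_power: "insertion m g (P ^ k) = insertion m g P ^ k"
  by (induction k) (simp_all add: insertion_mult)

lemma insertion_add: "insertion m g (P + Q) = insertion m g P + insertion m g Q"
  and insertion_diff: "insertion m g (P - Q) = insertion m g P - insertion m g Q"
  by (simp_all add: insertion_def linext_add linext_diff)

lemma insertion_X: 
  assumes "i < m"
  shows "insertion m g (X (Suc i)) = g i"
proof -
  have "(\<Prod>l<m. g l ^ Poly_Mapping.lookup (Poly_Mapping.single (Suc i) 1) (Suc l)) =
      (\<Prod>l<m. if l = i then g l else 1)"
    by (intro prod.cong) (auto simp: lookup_single when_def)
  then show ?thesis using assms by (simp add: insertion_def X_def)
qed

lemmas insertion_hom = insertion_mult insertion_prod insertion_power insertion_add insertion_diff

text \<open>\<open>insertion\<close> and \<open>const_coeff\<close> see only finitely many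
  variables; this predicate guarantees that the exponents they see determine the monomial.\<close>

definition vars_in :: "nat set \<Rightarrow> mpoly_int \<Rightarrow> bool" where
  "vars_in I P \<longleftrightarrow> (\<forall>a\<in>Poly_Mapping.keys P. \<forall>i. i \<notin> I \<longrightarrow> Poly_Mapping.lookup a i = 0)"

lemma vars_in_one: "vars_in I 1"
  by (simp add: vars_in_def)

lemma vars_in_X: "i \<in> I \<Longrightarrow> vars_in I (X i)"
  by (auto simp: vars_in_def X_def lookup_single when_def)

lemma vars_in_add: "vars_in I P \<Longrightarrow> vars_in I Q \<Longrightarrow> vars_in I (P + Q)"
  unfolding vars_in_def using Poly_Mapping.keys_add[of P Q] by blast

lemma vars_in_diff: "vars_in I P \<Longrightarrow> vars_in I Q \<Longrightarrow> vars_in I (P - Q)"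
  unfolding vars_in_def using keys_diff[of P Q] by blast

lemma vars_in_mult: "vars_in I P \<Longrightarrow> vars_in I Q \<Longrightarrow> vars_in I (P * Q)"
  unfolding vars_in_def using keys_mult[of P Q] by (fastforce simp: lookup_add)

lemma vars_in_prod: "(\<And>i. i \<in> A \<Longrightarrow> vars_in I (P i)) \<Longrightarrow> vars_in I (\<Prod>i\<in>A. P i)"
  by (induction A rule: infinite_finite_induct) (auto simp: vars_in_one vars_in_mult)

definition const_coeff :: "nat \<Rightarrow> mlaurent \<Rightarrow> rat" where
  "const_coeff m = linext (\<lambda>a. \<Prod>p<m. of_bool (Poly_Mapping.lookup a p = 0))"

text \<open>Dividing by the monomial moves the wanted coefficient to the constant term.\<close>

lemma coeff_monom_eq_const_coeff:
  assumes "vars_in {1..m} P"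
  shows "of_int (coeff_monom P {1..m} j) =
    const_coeff m ((\<Prod>p<m. emb p (shift (- int (j (Suc p))))) * insertion m (\<lambda>p. emb p (shift 1)) P)"
proof -
  let ?e = "\<Sum>i\<in>{1..m}. Poly_Mapping.single i (j i)"
  have e: "Poly_Mapping.lookup ?e i = (if i \<in> {1..m} then j i else 0)" for i
    by (simp add: lookup_sum lookup_single when_def)
  have "const_coeff m ((\<Prod>p<m. emb p (shift (- int (j (Suc p))))) * insertion m (\<lambda>p. emb p (shift 1)) P) =
    linext (\<lambda>a. \<Prod>p<m. of_bool (Poly_Mapping.lookup a p = int (j (Suc p)))) (insertion m (\<lambda>p. emb p (shift 1)) P)"
    unfolding const_coeff_def mult.commute[of "prod _ _"]
    by (subst linext_mult_prod_emb[where h = "\<lambda>_ x. of_bool (x = 0)"]) (simp_all add: act_shift)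
  also have "\<dots> = linext (\<lambda>a. \<Prod>p<m. of_bool (Poly_Mapping.lookup a (Suc p) = j (Suc p))) P"
    unfolding insertion_def linext_linext emb_power[symmetric]
    by (subst linext_prod_emb[where h = "\<lambda>p x. of_bool (x = int (j (Suc p)))"]) (simp_all add: shift_power)
  also have "\<dots> = linext (\<lambda>a. of_bool (a = ?e)) P"
    unfolding linext_def
  proof (intro sum.cong refl arg_cong2[of _ _ _ _ "(*)"])
    fix a assume "a \<in> Poly_Mapping.keys P"
    then have z: "Poly_Mapping.lookup a i = 0" if "i \<notin> {1..m}" for i
      using assms that by (auto simp: vars_in_def)
    have "(\<Prod>p<m. of_bool (Poly_Mapping.lookup a (Suc p) = j (Suc p)) :: rat) =
        of_bool (\<forall>p<m. Poly_Mapping.lookup a (Suc p) = j (Suc p))"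
      by (induction m) (auto simp: less_Suc_eq)
    moreover have "(\<forall>p<m. Poly_Mapping.lookup a (Suc p) = j (Suc p)) \<longleftrightarrow> a = ?e"
    proof
      assume l: "\<forall>p<m. Poly_Mapping.lookup a (Suc p) = j (Suc p)"
      show "a = ?e"
      proof (rule poly_mapping_eqI)
        fix i show "Poly_Mapping.lookup a i = Poly_Mapping.lookup ?e i"
          unfolding e using l[rule_format, of "i - 1"] z[of i] by (cases i) auto
      qed
    next
      assume "a = ?e"
      then show "\<forall>p<m. Poly_Mapping.lookup a (Suc p) = j (Suc p)"
        by (simp only: e) auto
    qed
    ultimately show "(\<Prod>p<m. of_bool (Poly_Mapping.lookup a (Suc p) = j (Suc p)) :: rat) = of_bool (a = ?e)" by simp
  qed
  also have "\<dots> = of_int (Poly_Mapping.lookup P ?e)"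
  proof -
    have "linext (\<lambda>a. of_bool (a = ?e) :: rat) P = (\<Sum>a\<in>Poly_Mapping.keys P. if a = ?e then of_int (Poly_Mapping.lookup P a) else 0)"
      unfolding linext_def by (intro sum.cong) auto
    then show ?thesis by (auto simp: in_keys_iff)
  qed
  finally show ?thesis by (simp add: coeff_monom_def)
qed

section \<open>Pairings of one-variable powers with binomials\<close>

lemma linext_mult_act: "linext \<phi> (f * g) = linext (act g \<phi>) f"
  by (simp add: act_zero[symmetric] act_mult del: act_zero)

text \<open>The a-th forward difference of \<open>binom x e\<close> at 0. With
  \<open>w = 1 + 1 / X\<close> it is the constant term of \<open>X powi (e - a)\<close>.\<close>

lemma binom_pairing_right:
  "linext (\<lambda>x. binom x e) ((shift 1 - 1) ^ a) = of_bool (a = e)"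
proof (induction a arbitrary: e)
  case 0
  then show ?case by (simp add: linext_one binom_zero_left)
next
  case (Suc a)
  have "linext (\<lambda>x. binom x e) ((shift 1 - 1) ^ Suc a) = linext (act (shift 1 - 1) (\<lambda>x. binom x e)) ((shift 1 - 1) ^ a)"
    by (simp only: power_Suc2 linext_mult_act)
  also have "act (shift 1 - 1) (\<lambda>x. binom x e) = (\<lambda>x. case e of 0 \<Rightarrow> 0 | Suc e' \<Rightarrow> binom x e')"
    by (rule ext) (rule act_diff_binom)
  finally show ?case using Suc by (cases e) (simp_all add: linext_def)
qed

text \<open>The constant term of \<open>X powi x * (- 1 - 1 / X) ^ e\<close>, an entry that a left
  variable contributes to the determinant.\<close>

definition left_entry :: "int \<Rightarrow> nat \<Rightarrow> rat" where
  "left_entry x e = linext (\<lambda>y. of_bool (y = 0)) (shift x * (- 1 - shift (-1)) ^ e)"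

lemma left_entry_0: "left_entry x 0 = of_bool (x = 0)"
  by (simp add: left_entry_def)

lemma left_entry_Suc: "left_entry x (Suc e) = - left_entry x e - left_entry (x - 1) e"
proof -
  have "shift x * (- 1 - shift (-1)) ^ Suc e =
      - (shift x * (- 1 - shift (-1)) ^ e) - shift (x - 1) * (- 1 - shift (-1)) ^ e"
    using shift_add[of x "-1"] by (simp add: algebra_simps)
  then show ?thesis by (simp only: left_entry_def linext_diff linext_uminus)
qed

lemma left_entry_neg: "x < 0 \<Longrightarrow> left_entry x e = 0"
  by (induction e arbitrary: x) (simp_all add: left_entry_0 left_entry_Suc)

text \<open>With \<open>w = 1 / (1 + X)\<close> the Laurent polynomial on the left is
  \<open>X ^ a * (1 + X)\<close>. By Pascal's rule both sides satisfy the recursion of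
  \<open>left_entry_Suc\<close> in \<open>e\<close>.\<close>

lemma binom_pairing_left:
  "linext (\<lambda>x. binom x e) ((shift (-1) - 1) ^ a * shift (-1)) = left_entry (int a) e"
proof (induction e arbitrary: a)
  case 0
  have "linext (\<lambda>x. binom x 0) ((shift (-1) - 1) ^ a * shift (-1)) = of_int (ev1 ((shift (-1) - 1) ^ a * shift (-1)))"
    by (simp add: ev1_def linext_def)
  also have "\<dots> = of_bool (a = 0)"
    by (cases a) (simp_all add: ev1_mult ev1_diff)
  finally show ?case by (simp add: left_entry_0)
next
  case (Suc e)
  have bm: "binom (x - 1) (Suc e) = binom x (Suc e) - binom (x - 1) e" for x
    using binom_Suc[of "x - 1" e] by simp
  show ?case
  proof (cases a)
    \<comment> \<open>For \<open>a = 0\<close> no difference factor is left to act with, and the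
      second term of the recursion has a negative exponent and vanishes.\<close>
    case 0
    have "binom (-1) (Suc e) = - binom (-1) e"
      using bm[of 0] by (simp add: binom_zero_left)
    then show ?thesis
      using Suc[of 0] 0 by (simp add: left_entry_Suc left_entry_neg)
  next
    case (Suc b)
    have "linext (\<lambda>x. binom x (Suc e)) ((shift (-1) - 1) ^ a * shift (-1)) =
        linext (\<lambda>x. binom x (Suc e)) (((shift (-1) - 1) ^ b * shift (-1)) * (shift (-1) - 1))"
      by (simp add: Suc mult_ac)
    also have "\<dots> = linext (act (shift (-1) - 1) (\<lambda>x. binom x (Suc e))) ((shift (-1) - 1) ^ b * shift (-1))"
      by (simp only: linext_mult_act)
    also have "act (shift (-1) - 1) (\<lambda>x. binom x (Suc e)) = act (- shift (-1)) (\<lambda>x. binom x e)"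
      by (rule ext) (simp add: act_diff act_uminus act_shift bm)
    also have "linext (act (- shift (-1)) (\<lambda>x. binom x e)) ((shift (-1) - 1) ^ b * shift (-1)) =
        linext (\<lambda>x. binom x e) ((shift (-1) - 1) ^ b * shift (-1) * (- shift (-1)))"
      by (simp only: linext_mult_act)
    also have "(shift (-1) - 1) ^ b * shift (-1) * (- shift (-1)) =
        - ((shift (-1) - 1) ^ b * shift (-1)) - ((shift (-1) - 1) ^ Suc b * shift (-1))"
      by (simp add: algebra_simps)
    finally show ?thesis
      using Suc.IH[of b] Suc.IH[of "Suc b"] by (simp add: linext_diff linext_uminus left_entry_Suc \<open>a = Suc b\<close>)
  qed
qed

section \<open>Extraction of the coefficient\<close>

lemma const_coeff_prod_emb:
  "const_coeff m (\<Prod>p<m. emb p (f p)) = (\<Prod>p<m. linext (\<lambda>x. of_bool (x = 0)) (f p))"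
  unfolding const_coeff_def by (rule linext_prod_emb) simp

text \<open>The change of variables: \<open>emb p (shift 1)\<close> means \<open>X_p\<close> under
  \<open>const_coeff\<close> and \<open>w_p\<close> under \<open>Lam\<close>. For a monomial
  \<open>F\<close> both sides are determinants, the first by expanding the Vandermonde product, and
  the entries agree by the two pairings; the general case is linear in \<open>F\<close>.\<close>

lemma const_coeff_vandermonde:
  assumes "c \<le> m"
  shows "const_coeff m (insertion m (\<lambda>p. emb p (shift (if p < c then 1 else -1))) F *
      (\<Prod>(p, q)\<in>pairs m. emb q (if q < c then - 1 - shift (-1) else shift 1) -
                                 emb p (if p < c then - 1 - shift (-1) else shift 1))) =
    Lam m (insertion m (\<lambda>p. emb p (shift (if p < c then -1 else 1) - 1)) F * (\<Prod>p<c. emb p (shift (-1))))"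
    (is "const_coeff m (?I F * ?V) = Lam m (?J F * ?W)")
proof -
  let ?\<nu> = "\<lambda>p. if p < c then - 1 - shift (-1) else shift 1"
  let ?g = "\<lambda>p a :: nat. shift (if p < c then int a else - int a)"
  let ?h = "\<lambda>p a :: nat. if p < c then (shift (-1) - 1) ^ a * shift (-1) else (shift 1 - 1) ^ a"
  have monomial: "const_coeff m ((\<Prod>p<m. emb p (shift (if p < c then 1 else -1)) ^ a p) * ?V) =
      Lam m ((\<Prod>p<m. emb p (shift (if p < c then -1 else 1) - 1) ^ a p) * ?W)" for a :: "nat \<Rightarrow> nat"
  proof -
    have "(\<Prod>p<m. emb p (shift (if p < c then 1 else -1)) ^ a p) = (\<Prod>p<m. emb p (?g p (a p)))"
      by (intro prod.cong) (auto simp: shift_power simp flip: emb_power)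
    moreover have "?V = (\<Sum>\<pi> | \<pi> permutes {0..<m}. of_int (sign \<pi>) * (\<Prod>p<m. emb p (?\<nu> p ^ \<pi> p)))"
      using det_vandermonde[of m "\<lambda>p. emb p (?\<nu> p)"]
      unfolding det_mat_leibniz atLeast0LessThan by (simp add: emb_power)
    ultimately have "(\<Prod>p<m. emb p (shift (if p < c then 1 else -1)) ^ a p) * ?V =
        (\<Sum>\<pi> | \<pi> permutes {0..<m}. of_int (sign \<pi>) * (\<Prod>p<m. emb p (?g p (a p) * ?\<nu> p ^ \<pi> p)))"
      by (simp add: sum_distrib_left emb_mult prod.distrib mult.left_commute)
    then have "const_coeff m ((\<Prod>p<m. emb p (shift (if p < c then 1 else -1)) ^ a p) * ?V) =
        (\<Sum>\<pi> | \<pi> permutes {0..<m}. of_int (sign \<pi>) *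
          const_coeff m (\<Prod>p<m. emb p (?g p (a p) * ?\<nu> p ^ \<pi> p)))"
      by (simp add: const_coeff_def linext_sum linext_cmult_int)
    also have "\<dots> = det (mat m m (\<lambda>(p, e). linext (\<lambda>x. of_bool (x = 0)) (?g p (a p) * ?\<nu> p ^ e)))"
      unfolding det_mat_leibniz const_coeff_prod_emb atLeast0LessThan by simp
    also have "\<dots> = det (mat m m (\<lambda>(p, e). linext (\<lambda>x. binom x e) (?h p (a p))))"
    proof -
      have "linext (\<lambda>x. of_bool (x = 0)) (?g p (a p) * ?\<nu> p ^ e) = linext (\<lambda>x. binom x e) (?h p (a p))" for p e
      proof (cases "p < c")
        case True
        then show ?thesis by (simp add: binom_pairing_left left_entry_def)
      next
        case False
        have "shift (- int (a p)) * shift (int e) = shift (int e - int (a p))"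
          by (simp flip: shift_add)
        then show ?thesis using False by (auto simp: binom_pairing_right shift_power)
      qed
      then show ?thesis by simp
    qed
    also have "\<dots> = Lam m (\<Prod>p<m. emb p (?h p (a p)))"
      unfolding Lam_def by (rule linext_det_prod_emb[symmetric, where h = "\<lambda>_ e x. binom x e"])
    also have "(\<Prod>p<m. emb p (?h p (a p))) = (\<Prod>p<m. emb p (shift (if p < c then -1 else 1) - 1) ^ a p) * ?W"
    proof -
      have "?W = (\<Prod>p<m. if p < c then emb p (shift (-1)) else 1)"
        using assms by (intro prod.mono_neutral_cong_left) auto
      then show ?thesis
        unfolding prod.distrib[symmetric]
        by (simp add: emb_mult emb_power prod.distrib[symmetric] cong: prod.cong)
           (intro prod.cong, auto simp: emb_mult emb_power)
    qed
    finally show ?thesis .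
  qed
  show ?thesis
  proof (rule frag_induction[OF subset_UNIV, of _ F])
    fix a show "const_coeff m (?I (frag_of a) * ?V) = Lam m (?J (frag_of a) * ?W)"
      using monomial[of "\<lambda>p. Poly_Mapping.lookup a (Suc p)"] by (simp add: insertion_def)
  next
    fix P Q assume "const_coeff m (?I P * ?V) = Lam m (?J P * ?W)" "const_coeff m (?I Q * ?V) = Lam m (?J Q * ?W)"
    then show "const_coeff m (?I (P - Q) * ?V) = Lam m (?J (P - Q) * ?W)"
      by (simp add: insertion_diff left_diff_distrib const_coeff_def Lam_def linext_diff)
  qed (simp add: insertion_def const_coeff_def Lam_def)
qed

text \<open>For \<open>p < c\<close> the variable with index \<open>p\<close> stands for \<open>X\<^sub>p\<close>, otherwise for \<open>1 / X\<^sub>p\<close>.\<close>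

definition reduced_pair :: "nat \<Rightarrow> nat \<Rightarrow> nat \<Rightarrow> mpoly_int" where
  "reduced_pair c p q = (if q < c then 1 + X (Suc p) + X (Suc p) * X (Suc q)
     else if c \<le> p then 1 + X (Suc q) + X (Suc p) * X (Suc q)
     else 1 - X (Suc p) * X (Suc q))"

text \<open>What remains of the given product, in these variables, after division by the monomial
  with exponents \<open>j\<close> and by the Vandermonde product of the overview.\<close>

definition reduced_poly :: "nat \<Rightarrow> nat \<Rightarrow> (nat \<Rightarrow> nat) \<Rightarrow> mpoly_int" where
  "reduced_poly m c e = (\<Prod>p<m. X (Suc p) ^ e p * (1 + X (Suc p))) * (\<Prod>(p, q)\<in>pairs m. reduced_pair c p q)"

lemma emb_shift_add: "emb p (shift (x + y)) = emb p (shift x) * emb p (shift y)"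
  by (simp add: shift_add emb_mult)

text \<open>From each pair the monomial \<open>X_p X_q\<close> is taken out. In total this gives
  \<open>X_p ^ (m - 1)\<close>, which combines with the division by \<open>X_p ^ j p\<close> to the
  exponents \<open>e\<close>.\<close>

lemma AST_product_factorization:
  fixes j :: "nat \<Rightarrow> nat"
  assumes j: "\<And>p. p < c \<Longrightarrow> e p + j p + 1 = m" "\<And>p. c \<le> p \<Longrightarrow> p < m \<Longrightarrow> j p = m + e p"
  defines "\<xi> \<equiv> \<lambda>p. emb p (shift 1)"
  shows "(\<Prod>p<m. emb p (shift (- int (j p)))) *
     ((\<Prod>p<m. 1 + \<xi> p) * (\<Prod>(p, q)\<in>pairs m. (1 + \<xi> p + \<xi> p * \<xi> q) * (\<xi> q - \<xi> p))) =
    insertion m (\<lambda>p. emb p (shift (if p < c then 1 else -1))) (reduced_poly m c e) *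
      (\<Prod>(p, q)\<in>pairs m. emb q (if q < c then - 1 - shift (-1) else shift 1) -
                                 emb p (if p < c then - 1 - shift (-1) else shift 1))"
proof -
  let ?\<eta> = "\<lambda>p. emb p (shift (-1))"
  let ?g = "\<lambda>p. emb p (shift (if p < c then 1 else -1))"
  let ?v = "\<lambda>p. emb p (if p < c then - 1 - shift (-1) else shift 1)"
  let ?B = "\<lambda>p q. insertion m ?g (reduced_pair c p q)"
  have inv: "\<xi> p * ?\<eta> p = 1" "\<xi> p * (?\<eta> p * y) = y" for p y
    by (simp_all add: \<xi>_def flip: mult.assoc)
  have pair: "(1 + \<xi> p + \<xi> p * \<xi> q) * (\<xi> q - \<xi> p) = (\<xi> p * \<xi> q) * (?B p q * (?v q - ?v p))"
    if pq: "p < q" "q < m" for p q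
  proof -
    have X: "insertion m ?g (X (Suc p)) = ?g p" "insertion m ?g (X (Suc q)) = ?g q"
      using pq by (simp_all add: insertion_X)
    consider "q < c" | "c \<le> p" | "p < c" "c \<le> q" by linarith
    then show ?thesis
    proof cases
      case 1
      then have "?B p q = 1 + \<xi> p + \<xi> p * \<xi> q" "?v q - ?v p = ?\<eta> p - ?\<eta> q"
        using pq by (simp_all add: reduced_pair_def insertion_hom X \<xi>_def emb_diff emb_uminus)
      moreover have "\<xi> p * \<xi> q * (?\<eta> p - ?\<eta> q) = \<xi> q - \<xi> p"
        by (simp add: algebra_simps inv)
      ultimately show ?thesis by (simp add: mult_ac)
    next
      case 2
      then have "?B p q = 1 + ?\<eta> q + ?\<eta> p * ?\<eta> q" "?v q - ?v p = \<xi> q - \<xi> p"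
        using pq by (simp_all add: reduced_pair_def insertion_hom X \<xi>_def)
      moreover have "\<xi> p * \<xi> q * (1 + ?\<eta> q + ?\<eta> p * ?\<eta> q) = 1 + \<xi> p + \<xi> p * \<xi> q"
        by (simp add: algebra_simps inv mult.left_commute[of "\<xi> q" "?\<eta> p"])
      ultimately show ?thesis by (simp only: mult.assoc[symmetric])
    next
      \<comment> \<open>For a mixed pair the roles are exchanged: \<open>1 + X_p + X_p X_q\<close>
        yields the Vandermonde difference \<open>X_q + 1 + 1 / X_p\<close>, and
        \<open>X_q - X_p\<close> leaves \<open>1 - X_p / X_q\<close>.\<close>
      case 3
      then have "?B p q = 1 - \<xi> p * ?\<eta> q" "?v q - ?v p = \<xi> q + 1 + ?\<eta> p"
        using pq by (simp_all add: reduced_pair_def insertion_hom X \<xi>_def emb_diff emb_uminus)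
      moreover have "\<xi> p * \<xi> q * ((1 - \<xi> p * ?\<eta> q) * (\<xi> q + 1 + ?\<eta> p)) =
          (\<xi> q * (1 - \<xi> p * ?\<eta> q)) * (\<xi> p * (\<xi> q + 1 + ?\<eta> p))"
        by (simp only: mult_ac)
      moreover have "\<xi> q * (1 - \<xi> p * ?\<eta> q) = \<xi> q - \<xi> p" "\<xi> p * (\<xi> q + 1 + ?\<eta> p) = 1 + \<xi> p + \<xi> p * \<xi> q"
        by (simp_all add: algebra_simps inv)
      ultimately show ?thesis by (simp only: mult.commute)
    qed
  qed
  have single: "emb p (shift (- int (j p))) * (1 + \<xi> p) * \<xi> p ^ (m - 1) = ?g p ^ e p * (1 + ?g p)" if p: "p < m" for p
  proof (cases "p < c")
    case True
    then have "int (m - 1) - int (j p) = int (e p)" using j(1)[OF True] by linarith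
    then have "emb p (shift (- int (j p))) * \<xi> p ^ (m - 1) = \<xi> p ^ e p"
      by (simp add: \<xi>_def shift_power flip: emb_power emb_shift_add)
    then show ?thesis using True by (simp add: \<xi>_def mult_ac)
  next
    case False
    then have "int (m - 1) - int (j p) = - int (e p) - 1" using j(2)[of p] p by linarith
    then have *: "- int (j p) + int (m - 1) = - int (e p) + - 1" by simp
    have "emb p (shift (- int (j p))) * \<xi> p ^ (m - 1) = emb p (shift (- int (j p) + int (m - 1)))"
      by (simp only: emb_shift_add \<xi>_def emb_power[symmetric] shift_power mult_1_right)
    also have "\<dots> = ?\<eta> p ^ e p * ?\<eta> p"
      unfolding * emb_shift_add by (simp add: shift_power flip: emb_power)
    finally have "emb p (shift (- int (j p))) * \<xi> p ^ (m - 1) = ?\<eta> p ^ e p * ?\<eta> p" .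
    then have "emb p (shift (- int (j p))) * (1 + \<xi> p) * \<xi> p ^ (m - 1) = ?\<eta> p ^ e p * (?\<eta> p * (1 + \<xi> p))"
      by (simp add: mult_ac)
    also have "?\<eta> p * (1 + \<xi> p) = 1 + ?\<eta> p"
      by (simp add: algebra_simps \<xi>_def)
    finally show ?thesis using False by simp
  qed
  have "(\<Prod>(p, q)\<in>pairs m. (1 + \<xi> p + \<xi> p * \<xi> q) * (\<xi> q - \<xi> p)) =
      (\<Prod>(p, q)\<in>pairs m. (\<xi> p * \<xi> q) * (?B p q * (?v q - ?v p)))"
    by (intro prod.cong refl) (auto simp: pair)
  also have "\<dots> = (\<Prod>(p, q)\<in>pairs m. \<xi> p * \<xi> q) * ((\<Prod>(p, q)\<in>pairs m. ?B p q) * (\<Prod>(p, q)\<in>pairs m. ?v q - ?v p))"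
    unfolding case_prod_unfold prod.distrib ..
  finally have pairs: "(\<Prod>(p, q)\<in>pairs m. (1 + \<xi> p + \<xi> p * \<xi> q) * (\<xi> q - \<xi> p)) =
      (\<Prod>p<m. \<xi> p ^ (m - 1)) * ((\<Prod>(p, q)\<in>pairs m. ?B p q) * (\<Prod>(p, q)\<in>pairs m. ?v q - ?v p))"
    unfolding prod_pairs_mult .
  have "insertion m ?g (reduced_poly m c e) =
      (\<Prod>p<m. ?g p ^ e p * (1 + ?g p)) * (\<Prod>(p, q)\<in>pairs m. ?B p q)"
    unfolding reduced_poly_def
    by (simp add: insertion_hom insertion_X case_prod_unfold)
  also have "(\<Prod>p<m. ?g p ^ e p * (1 + ?g p)) = (\<Prod>p<m. emb p (shift (- int (j p))) * (1 + \<xi> p) * \<xi> p ^ (m - 1))"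
    using single by (intro prod.cong) auto
  finally show ?thesis
    unfolding pairs by (simp only: prod.distrib mult_ac)
qed

lemma prod_pairs_split:
  fixes F G :: "nat \<Rightarrow> nat \<Rightarrow> 'a::comm_monoid_mult"
  assumes "c \<le> m"
  shows "(\<Prod>(p, q)\<in>pairs m. if p < c \<and> c \<le> q then G p q else F p q) =
     (\<Prod>(p, q)\<in>{(p, q). (p, q) \<in> pairs m \<and> \<not> (p < c \<and> c \<le> q)}. F p q) * (\<Prod>l<c. \<Prod>q\<in>{c..<m}. G l q)"
proof -
  let ?D = "{(p, q). (p, q) \<in> pairs m \<and> \<not> (p < c \<and> c \<le> q)}"
  let ?F = "\<lambda>(p, q). if p < c \<and> c \<le> q then G p q else F p q"
  have fin: "finite ?D" by (rule finite_subset[OF _ finite_pairs[of m]]) auto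
  have eq: "pairs m = ?D \<union> {..<c} \<times> {c..<m}" and disj: "?D \<inter> {..<c} \<times> {c..<m} = {}"
    using assms by auto
  have "prod ?F (pairs m) = prod ?F ?D * prod ?F ({..<c} \<times> {c..<m})"
    by (subst eq, rule prod.union_disjoint[OF fin _ disj]) simp
  also have "prod ?F ?D = (\<Prod>(p, q)\<in>?D. F p q)"
    by (intro prod.cong) auto
  also have "prod ?F ({..<c} \<times> {c..<m}) = (\<Prod>l<c. \<Prod>q\<in>{c..<m}. G l q)"
    unfolding prod.cartesian_product by (intro prod.cong) auto
  finally show ?thesis .
qed

lemma prod_lessThan_if:
  "c \<le> (m :: nat) \<Longrightarrow> (\<Prod>p<c. f p) = (\<Prod>p<m. if p < c then f p else (1 :: 'a::comm_monoid_mult))"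
  by (intro prod.mono_neutral_cong_left) auto

text \<open>Substituting \<open>1 / w - 1\<close> on the left and \<open>w - 1\<close> on the right
  turns every pair factor into some \<open>nf\<close>, divided by its left variables. Mixed pairs
  come out as \<open>nf q p\<close>, in the wrong order, which \<open>Lam_rotate\<close>
  reverses.\<close>

lemma Lam_reduced_poly:
  assumes cm: "c \<le> m"
  shows "Lam m (insertion m (\<lambda>p. emb p (shift (if p < c then -1 else 1) - 1)) (reduced_poly m c e) *
      (\<Prod>p<c. emb p (shift (-1)))) =
    bethe m (\<lambda>p. if p < c then (1 - shift 1) ^ e p * shift (- int (e p) - 1) else (shift 1 - 1) ^ e p * shift 1)"
proof -
  let ?h = "\<lambda>p. emb p (shift (if p < c then -1 else 1) - 1)"
  let ?\<kappa> = "\<lambda>p. if p < c then emb p (shift (-1)) else 1"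
  let ?\<xi> = "\<lambda>p. emb p (shift 1)" and ?\<eta> = "\<lambda>p. emb p (shift (-1))"
  let ?f = "\<lambda>p. if p < c then (1 - shift 1) ^ e p * shift (- int (e p) - 1) else (shift 1 - 1) ^ e p * shift 1"
  have inv: "?\<xi> p * (?\<eta> p * y) = y" "?\<xi> p * (y * ?\<eta> p) = y" "?\<xi> p * (?\<xi> q * (?\<eta> p * ?\<eta> q)) = 1" for p q y
  proof -
    show "?\<xi> p * (?\<eta> p * y) = y" for y by (simp flip: mult.assoc)
    then show "?\<xi> p * (y * ?\<eta> p) = y" by (simp only: mult.commute[of y])
    have "?\<xi> p * (?\<xi> q * (?\<eta> p * ?\<eta> q)) = (?\<xi> p * ?\<eta> p) * (?\<xi> q * ?\<eta> q)" by (simp only: mult_ac)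
    then show "?\<xi> p * (?\<xi> q * (?\<eta> p * ?\<eta> q)) = 1" by simp
  qed
  have pair: "insertion m ?h (reduced_pair c p q) = (?\<kappa> p * ?\<kappa> q) * (if p < c \<and> c \<le> q then nf q p else nf p q)"
    if pq: "p < q" "q < m" for p q
  proof -
    have X: "insertion m ?h (X (Suc p)) = ?h p" "insertion m ?h (X (Suc q)) = ?h q"
      using pq by (simp_all add: insertion_X)
    have 1: "insertion m ?h (reduced_pair c p q) = (if q < c then 1 + ?h p + ?h p * ?h q
        else if c \<le> p then 1 + ?h q + ?h p * ?h q else 1 - ?h p * ?h q)"
      unfolding reduced_pair_def by (simp add: insertion_hom X)
    consider "q < c" | "c \<le> p" | "p < c" "c \<le> q" by linarith
    then show ?thesis
      unfolding 1 by cases (use pq in \<open>auto simp: nf_def emb_diff algebra_simps inv\<close>)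
  qed
  let ?D = "{(p, q). (p, q) \<in> pairs m \<and> \<not> (p < c \<and> c \<le> q)}"
  have ins: "insertion m ?h (reduced_poly m c e) =
      (\<Prod>p<m. ?h p ^ e p * (1 + ?h p)) * ((\<Prod>p<m. ?\<kappa> p ^ (m - 1)) *
        ((\<Prod>(p, q)\<in>?D. nf p q) * (\<Prod>l<c. \<Prod>q\<in>{c..<m}. nf q l)))"
  proof -
    have "(\<Prod>(p, q)\<in>pairs m. insertion m ?h (reduced_pair c p q)) =
        (\<Prod>(p, q)\<in>pairs m. (?\<kappa> p * ?\<kappa> q) * (if p < c \<and> c \<le> q then nf q p else nf p q))"
      by (intro prod.cong refl) (auto simp: pair)
    also have "\<dots> = (\<Prod>(p, q)\<in>pairs m. ?\<kappa> p * ?\<kappa> q) * (\<Prod>(p, q)\<in>pairs m. if p < c \<and> c \<le> q then nf q p else nf p q)"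
      unfolding case_prod_unfold prod.distrib ..
    finally have "(\<Prod>(p, q)\<in>pairs m. insertion m ?h (reduced_pair c p q)) =
        (\<Prod>p<m. ?\<kappa> p ^ (m - 1)) * ((\<Prod>(p, q)\<in>?D. nf p q) * (\<Prod>l<c. \<Prod>q\<in>{c..<m}. nf q l))"
      unfolding prod_pairs_mult prod_pairs_split[OF cm, of "\<lambda>p q. nf q p" nf] .
    then show ?thesis
      unfolding reduced_poly_def by (simp add: insertion_hom insertion_X case_prod_unfold)
  qed
  \<comment> \<open>All one-variable factors. Besides \<open>?h p ^ e p * (1 + ?h p)\<close>, a left
    variable carries \<open>1 / w\<close> to the power \<open>m\<close>: \<open>m - 1\<close> from
    the pairs and one from the final product. This cancels the \<open>w_l ^ m\<close> produced by
    \<open>Lam_rotate\<close>.\<close>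
  define H where "H = (\<Prod>p<m. ?h p ^ e p * (1 + ?h p)) * (\<Prod>p<m. ?\<kappa> p ^ (m - 1)) * (\<Prod>p<c. ?\<eta> p)"
  have n: "nprod m = (\<Prod>(p, q)\<in>?D. nf p q) * (\<Prod>l<c. \<Prod>q\<in>{c..<m}. nf l q)"
    unfolding nprod_def using prod_pairs_split[OF cm, of nf nf] by simp
  have H: "H * (\<Prod>l<c. ?\<xi> l ^ m) = (\<Prod>p<m. emb p (?f p))"
  proof -
    have "?h p ^ e p * (1 + ?h p) * ?\<kappa> p ^ (m - 1) * (if p < c then ?\<eta> p else 1) * (if p < c then ?\<xi> p ^ m else 1) =
        emb p (?f p)" if p: "p < m" for p
    proof (cases "p < c")
      case True
      have "0 < m" using p by simp
      then have "?\<eta> p ^ (m - 1) * ?\<eta> p * ?\<xi> p ^ m = (?\<eta> p * ?\<xi> p) ^ m"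
        by (simp only: power_mult_distrib power_minus_mult)
      then have 1: "?\<eta> p ^ (m - 1) * ?\<eta> p * ?\<xi> p ^ m = 1" by simp
      have "?h p = (1 - ?\<xi> p) * ?\<eta> p"
        using True by (simp add: emb_diff algebra_simps)
      then have "?h p ^ e p = emb p ((1 - shift 1) ^ e p * shift (- int (e p)))"
        by (simp add: power_mult_distrib emb_mult emb_power emb_diff shift_power flip: emb_power[of p "shift (-1)"])
      moreover have "emb p (?f p) = emb p ((1 - shift 1) ^ e p * shift (- int (e p))) * ?\<eta> p"
        using True emb_shift_add[of p "- int (e p)" "-1"] by (simp add: emb_mult mult.assoc)
      moreover have "1 + ?h p = ?\<eta> p" using True by (simp add: emb_diff)
      ultimately have "?h p ^ e p * (1 + ?h p) * (?\<eta> p ^ (m - 1) * ?\<eta> p * ?\<xi> p ^ m) = emb p (?f p)"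
        unfolding 1 by (simp only: mult_1_right)
      then show ?thesis using True by (simp add: mult.assoc)
    next
      case False
      then show ?thesis by (simp add: emb_diff emb_mult emb_power)
    qed
    then show ?thesis
      unfolding H_def prod_lessThan_if[OF cm] prod.distrib[symmetric] by (intro prod.cong) auto
  qed
  have "Lam m (insertion m ?h (reduced_poly m c e) * (\<Prod>p<c. ?\<eta> p)) =
      Lam m ((H * (\<Prod>(p, q)\<in>?D. nf p q)) * (\<Prod>l<c. \<Prod>q\<in>{c..<m}. nf q l))"
    unfolding ins H_def by (simp only: mult_ac)
  also have "\<dots> = Lam m ((H * (\<Prod>l<c. ?\<xi> l ^ m)) * nprod m)"
    unfolding Lam_rotate[OF cm] n by (simp only: mult_ac)
  finally show ?thesis unfolding H bethe_def .
qed

lemma downward_closed_initial: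
  fixes m :: nat
  assumes "\<And>p q. p < q \<Longrightarrow> q < m \<Longrightarrow> Q q \<Longrightarrow> Q p"
  obtains c where "c \<le> m" "\<And>p. p < m \<Longrightarrow> Q p \<longleftrightarrow> p < c"
proof -
  have "\<exists>c\<le>m. \<forall>p<m. Q p \<longleftrightarrow> p < c"
    using assms
  proof (induction m)
    case (Suc m)
    then obtain c where c: "c \<le> m" "\<forall>p<m. Q p \<longleftrightarrow> p < c" by (meson less_SucI)
    show ?case
    proof (cases "Q m")
      case True
      then show ?thesis using Suc.prems[of _ m] by (intro exI[of _ "Suc m"]) (auto simp: less_Suc_eq)
    next
      case False
      then show ?thesis using c by (intro exI[of _ c]) (auto simp: less_Suc_eq)
    qed
  qed simp
  then show ?thesis using that by blast
qed

section \<open>From prescribed positions to column weights and on to the coefficient\<close>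

theorem theorem1p2:
  fixes n :: nat and j :: "nat \<Rightarrow> nat"
  assumes "n \<ge> 1"
    and "strict_mono_on {1..n - 1} j"
    and "\<And>i. i \<in> {1..n - 1} \<Longrightarrow> j i \<le> 2 * n - 3"
  shows "int (num_AST n j) =
    coeff_monom
      ((\<Prod>i\<in>{1..n - 1}. 1 + X i) *
       (\<Prod>(i, k)\<in>{(i, k). 1 \<le> i \<and> i < k \<and> k \<le> n - 1}. (1 + X i + X i * X k) * (X k - X i)))
      {1..n - 1} j"
proof -
  define m where "m = n - 1"
  have n: "n = Suc m" using assms(1) by (simp add: m_def)
  define J where "J p = j (Suc p)" for p
  have J_less: "J p < J q" if "p < q" "q < m" for p q
    using assms(2) that by (auto simp: J_def m_def strict_mono_on_def)
  have J_bound: "J p \<le> 2 * m - 1" if "p < m" for p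
    using assms(3)[of "Suc p"] that by (auto simp: J_def n)
  \<comment> \<open>Positions below \<open>m\<close> are those left of the centre, so
    \<open>c\<close> is the number of prescribed left columns.\<close>
  obtain c where cm: "c \<le> m" and c: "\<And>p. p < m \<Longrightarrow> J p < m \<longleftrightarrow> p < c"
    using downward_closed_initial[of m "\<lambda>p. J p < m"] J_less by (metis order_less_trans)
  \<comment> \<open>The inverse of \<open>col_position\<close>: columns are numbered from 1 and the
    central column \<open>n\<close> is skipped.\<close>
  define x where "x p = (if J p < m then J p + 1 else J p + 2)" for p
  define C where "C = x ` {..<m}"
  have "sorted_wrt (<) (map x [0..<m])"
    using J_less by (auto simp: sorted_wrt_map sorted_wrt_iff_nth_less x_def intro: less_trans dest: J_less)
  then have xs: "sorted_list_of_set C = map x [0..<m]" and card: "card C = m"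
    using sorted_list_of_set.idem_if_sorted_distinct[of "map x [0..<m]"] distinct_card[of "map x [0..<m]"]
    by (auto simp: C_def strict_sorted_iff atLeast0LessThan)
  have C: "C \<subseteq> {1..2 * n - 1} - {n}"
  proof
    fix y assume "y \<in> C"
    then obtain p where p: "p < m" "y = x p" by (auto simp: C_def)
    then show "y \<in> {1..2 * n - 1} - {n}" using J_bound[of p] by (auto simp: x_def n)
  qed
  have "col_position n (x p) = J p" if "p < m" for p
    by (auto simp: col_position_def x_def n)
  then have "col_position n ` C = J ` {..<m}"
    unfolding C_def image_image by (intro image_cong) auto
  also have "\<dots> = j ` {1..n - 1}"
    unfolding J_def n using image_image[of j Suc "{..<m}"] by (simp add: image_Suc_lessThan)
  finally have "num_AST n j = nchains n m C"
    using num_AST_eq_nchains[OF assms(1) C] by (simp add: m_def)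
  then have "of_nat (num_AST n j) = bethe m (\<lambda>p. one_weight n m (map x [0..<m] ! p))"
    using nchains_eq_bethe[of m n C] C card unfolding xs by (auto simp: n)
  \<comment> \<open>The number of rows, up to row \<open>m\<close>, for which the column has been
    inactive; this is the exponent of \<open>1 - w\<close> or \<open>w - 1\<close> in
    \<open>one_weight n m\<close>.\<close>
  also define e where "e p = (if p < c then m - 1 - J p else J p - m)" for p
  have e: "e p + J p + 1 = m" if "p < c" for p
    using c[of p] that cm by (auto simp: e_def)
  have e': "J p = m + e p" if "c \<le> p" "p < m" for p
    using c[of p] that by (auto simp: e_def)
  have "bethe m (\<lambda>p. one_weight n m (map x [0..<m] ! p)) =
    bethe m (\<lambda>p. if p < c then (1 - shift 1) ^ e p * shift (- int (e p) - 1) else (shift 1 - 1) ^ e p * shift 1)"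
  proof (rule bethe_cong)
    fix p assume p: "p < m"
    show "one_weight n m (map x [0..<m] ! p) =
      (if p < c then (1 - shift 1) ^ e p * shift (- int (e p) - 1) else (shift 1 - 1) ^ e p * shift 1)"
    proof (cases "p < c")
      case True
      have "x p = J p + 1" using c[OF p] True by (simp add: x_def)
      moreover have "m - (J p + 1) = e p" "int (J p + 1) - int n = - int (e p) - 1" "J p + 1 \<le> m"
        using e[OF True] by (auto simp: n)
      \<comment> \<open>For \<open>J p + 1 = m\<close> the column is the leftmost one still active
        in row \<open>m\<close>, and \<open>e p = 0\<close>.\<close>
      ultimately show ?thesis using True p by (cases "J p + 1 = m") (auto simp: one_weight_def n)
    next
      case False
      have "x p = J p + 2" using c[OF p] False by (simp add: x_def)
      moreover have "J p = m + e p" using e'[of p] False p by simp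
      ultimately show ?thesis using False p by (auto simp: one_weight_def n)
    qed
  qed
  also have "\<dots> = Lam m (insertion m (\<lambda>p. emb p (shift (if p < c then -1 else 1) - 1)) (reduced_poly m c e) *
      (\<Prod>p<c. emb p (shift (-1))))"
    by (rule Lam_reduced_poly[OF cm, symmetric])
  also have "\<dots> = const_coeff m ((\<Prod>p<m. emb p (shift (- int (J p)))) *
     ((\<Prod>p<m. 1 + emb p (shift 1)) * (\<Prod>(p, q)\<in>pairs m.
        (1 + emb p (shift 1) + emb p (shift 1) * emb q (shift 1)) * (emb q (shift 1) - emb p (shift 1)))))"
    unfolding const_coeff_vandermonde[OF cm, symmetric]
    by (rule arg_cong[of _ _ "const_coeff m"], rule AST_product_factorization[symmetric]) (use e e' in auto)
  also have "(\<Prod>p<m. 1 + emb p (shift 1)) * (\<Prod>(p, q)\<in>pairs m.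
        (1 + emb p (shift 1) + emb p (shift 1) * emb q (shift 1)) * (emb q (shift 1) - emb p (shift 1))) =
      insertion m (\<lambda>p. emb p (shift 1)) ((\<Prod>i\<in>{1..n - 1}. 1 + X i) *
       (\<Prod>(i, k)\<in>{(i, k). 1 \<le> i \<and> i < k \<and> k \<le> n - 1}. (1 + X i + X i * X k) * (X k - X i)))"
  proof -
    let ?ins = "insertion m (\<lambda>p. emb p (shift 1))"
    have "(\<Prod>p<m. 1 + emb p (shift 1)) = ?ins (\<Prod>i\<in>{1..n - 1}. 1 + X i)"
      unfolding insertion_prod
      by (rule prod.reindex_bij_witness[of _ "\<lambda>i. i - 1" Suc]) (auto simp: n insertion_add insertion_X)
    moreover have "(\<Prod>(p, q)\<in>pairs m.
        (1 + emb p (shift 1) + emb p (shift 1) * emb q (shift 1)) * (emb q (shift 1) - emb p (shift 1))) =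
      ?ins (\<Prod>(i, k)\<in>{(i, k). 1 \<le> i \<and> i < k \<and> k \<le> n - 1}. (1 + X i + X i * X k) * (X k - X i))"
      unfolding insertion_prod
      by (rule prod.reindex_bij_witness[of _ "\<lambda>(i, k). (i - 1, k - 1)" "\<lambda>(p, q). (Suc p, Suc q)"])
         (auto simp: n insertion_hom insertion_X)
    ultimately show ?thesis by (simp only: insertion_mult)
  qed
  also have "const_coeff m ((\<Prod>p<m. emb p (shift (- int (J p)))) *
      insertion m (\<lambda>p. emb p (shift 1)) ((\<Prod>i\<in>{1..n - 1}. 1 + X i) *
       (\<Prod>(i, k)\<in>{(i, k). 1 \<le> i \<and> i < k \<and> k \<le> n - 1}. (1 + X i + X i * X k) * (X k - X i)))) =
    of_int (coeff_monom ((\<Prod>i\<in>{1..n - 1}. 1 + X i) *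
       (\<Prod>(i, k)\<in>{(i, k). 1 \<le> i \<and> i < k \<and> k \<le> n - 1}. (1 + X i + X i * X k) * (X k - X i))) {1..n - 1} j)"
    unfolding J_def m_def
  proof (rule coeff_monom_eq_const_coeff[symmetric])
    show "vars_in {1..n - 1} ((\<Prod>i\<in>{1..n - 1}. 1 + X i) *
       (\<Prod>(i, k)\<in>{(i, k). 1 \<le> i \<and> i < k \<and> k \<le> n - 1}. (1 + X i + X i * X k) * (X k - X i)))"
    proof (rule vars_in_mult; rule vars_in_prod)
      fix i assume "i \<in> {1..n - 1}"
      then show "vars_in {1..n - 1} (1 + X i)" by (intro vars_in_add vars_in_one vars_in_X)
    next
      fix y assume "y \<in> {(i, k). 1 \<le> i \<and> i < k \<and> k \<le> n - 1}"
      then obtain i k where y: "y = (i, k)" and ik: "i \<in> {1..n - 1}" "k \<in> {1..n - 1}" by auto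
      from ik show "vars_in {1..n - 1} (case y of (i, k) \<Rightarrow> (1 + X i + X i * X k) * (X k - X i))"
        unfolding y prod.case by (intro vars_in_mult vars_in_add vars_in_diff vars_in_one vars_in_X)
    qed
  qed
  \<comment> \<open>The chain of equalities lives in \<open>rat\<close> and descends to
    \<open>int\<close> because \<open>of_int\<close> is injective.\<close>
  finally show ?thesis
    unfolding of_int_of_nat_eq[where 'a = rat, of "num_AST n j", symmetric] of_int_eq_iff .
qed

end
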